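(* The function $f$ satisfies \[ f(n) \le \big(3.71943 + o(1)\big)\frac{n}{(\log n)^2}. \] Moreover, if for all positive integers $s,t,k$ with $st \le k^2$ one has $R(s,t) \le R(k,k)$, then \[ f(n) \le \big(3.70831 + o(1)\big)\frac{n}{(\log n)^2}. \]
   Context: All logarithms are in base 2. For positive integers $s,t$, the Ramsey number $R(s,t)$ is the minimum $n$ such that every red/blue edge-coloring of the complete graph $K_n$ contains a red clique on $s$ vertices or a blue clique on $t$ vertices. For a graph $G$, $\chi(G)$ is its chromatic number and $\omega(G)$ its clique number. For $n \in \mathbb{N}$, $f(n)$ is the maximum of $\chi(G)/\omega(G)$ over all graphs $G$ on $n$ vertices. Here $o(1)$ denotes a quantity tending to $0$ as $n \to \infty$. *)

theory Defs
  imports Complex_Main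
begin

definition is_graph :: "nat \<Rightarrow> nat set set \<Rightarrow> bool" where
  "is_graph n E \<longleftrightarrow> (\<forall>e\<in>E. card e = 2 \<and> e \<subseteq> {0..<n})"

definition chromatic_number :: "nat \<Rightarrow> nat set set \<Rightarrow> nat" where
  "chromatic_number n E = (LEAST k. \<exists>c :: nat \<Rightarrow> nat.
      (\<forall>v<n. c v < k) \<and> (\<forall>u<n. \<forall>v<n. {u, v} \<in> E \<longrightarrow> c u \<noteq> c v))"

definition is_clique :: "nat \<Rightarrow> nat set set \<Rightarrow> nat set \<Rightarrow> bool" where
  "is_clique n E K \<longleftrightarrow> K \<subseteq> {0..<n} \<and> (\<forall>u\<in>K. \<forall>v\<in>K. u \<noteq> v \<longrightarrow> {u, v} \<in> E)"

definition clique_number :: "nat \<Rightarrow> nat set set \<Rightarrow> nat" where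
  "clique_number n E = Max (card ` {K. is_clique n E K})"

definition f_ratio :: "nat \<Rightarrow> real" where
  "f_ratio n = Max {real (chromatic_number n E) / real (clique_number n E) | E. is_graph n E}"

definition ramsey :: "nat \<Rightarrow> nat \<Rightarrow> nat" where
  "ramsey s t = (LEAST n. \<forall>red :: nat set \<Rightarrow> bool. \<exists>K \<subseteq> {0..<n}.
      (card K = s \<and> (\<forall>u\<in>K. \<forall>v\<in>K. u \<noteq> v \<longrightarrow> red {u, v})) \<or>
      (card K = t \<and> (\<forall>u\<in>K. \<forall>v\<in>K. u \<noteq> v \<longrightarrow> \<not> red {u, v})))"

end

(*
  The proof bounds R(k,l) for balanced k, l by an exponentially improved Erdos--Szekeres bound, in the spirit of
  Campos, Griffiths, Morris, Sahasrabudhe and of Gupta, Ndiaye, Norin, Wei.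

  For vertex sets X, Y (possibly overlapping) let theta be the excess of the red density between X and Y over a fixed p.
  The potential |X| |Y| theta^K, K a large constant, is followed along a recursion that replaces (X, Y) by the
  red or the blue neighbourhood of a vertex v in X together with the red neighbourhood of v in Y: by Cauchy--Schwarz
  some v does not decrease theta on average, so what is lost in the red part of X is gained in the blue part.  If many
  vertices of X have blue degree at least mu |X|, a blue book in X is used instead.  When X becomes small, Y is large
  enough to contain the missing clique by a Ramsey bound for smaller parameters.

  The bounds R(k,l) <= exp(a k + b l + o(k + l)) are proved simultaneously for a finite set of pairs (a, b) by
  induction on k + l.  The bound for R(k,l-1) makes every vertex have blue degree at most exp(-b) n, so that
  p = 1 - exp(-b) is admissible; the bounds for smaller k serve for the set Y.  For a suitable numerical family
  the resulting exponent is at most sqrt(1.78 k l) for all k, l, also off the diagonal, and 1.78 < 3.70831 (ln 2)^2.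
  Hence every set of n / (log n)^3 vertices in a graph with clique number w contains an independent set of size about
  (ln n)^2 / (1.78 w), and colouring greedily with such sets gives the theorem.
*)
theory Submission
  imports Defs "HOL-Analysis.Analysis" "HOL-Real_Asymp.Real_Asymp"
begin

section \<open>Cliques in two-coloured vertex sets\<close>

text \<open>The recursion starts with X = Y = V and potential about n^2; this is the origin of the
  factor 2 in \<open>A * k + (\<gamma> + b') * l \<le> 2 * (a * k + b * l)\<close>, the inequality
  asked of each row. A red step costs \<open>A\<close>, a blue one \<open>\<gamma>\<close>. The
  final Y costs \<open>a' * k' + b' * l\<close>: the unspent red budget covers
  \<open>a' * k'\<close> because \<open>a' \<le> A\<close>, but Y only ever passes to red
  neighbourhoods, so the blue clique forbidden in it keeps its full size \<open>l\<close> and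
  \<open>b' * l\<close> is paid in full.

  The inequality need not hold for all k and l. It is required only on the cone where (a, b) is
  smallest among the lines, since the bound for the smallest line implies the others there. Hence
  the whole family, closed under exchange of the colours, goes through one induction. The induction
  must reproduce its constant C unchanged, which works because the occurrences of ln C on both sides
  balance exactly.

  The exponent K separates scales: the first-order terms of a step cancel, the errors are of order 1
  / K^2, and a slack of order 1 / K per step absorbs them.\<close>

definition has_clique :: "('a \<Rightarrow> 'a \<Rightarrow> bool) \<Rightarrow> 'a set \<Rightarrow> nat \<Rightarrow> bool" where
  "has_clique R V k \<longleftrightarrow> (\<exists>K\<subseteq>V. finite K \<and> card K = k \<and> (\<forall>u\<in>K. \<forall>v\<in>K. u \<noteq> v \<longrightarrow> R u v))"

lemma has_clique_mono: "has_clique R V k \<Longrightarrow> V \<subseteq> W \<Longrightarrow> has_clique R W k"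
  unfolding has_clique_def by blast

lemma has_clique_0 [simp]: "has_clique R V 0"
  unfolding has_clique_def by (intro exI[of _ "{}"]) auto

lemma has_clique_le:
  assumes "has_clique R V k" "j \<le> k"
  shows "has_clique R V j"
proof -
  obtain K where K: "K \<subseteq> V" "finite K" "card K = k" "\<forall>u\<in>K. \<forall>v\<in>K. u \<noteq> v \<longrightarrow> R u v"
    using assms(1) unfolding has_clique_def by blast
  obtain S where "S \<subseteq> K" "card S = j" "finite S"
    using obtain_subset_with_card_n[of j K] K assms(2) by auto
  then show ?thesis unfolding has_clique_def using K by (intro exI[of _ S]) blast
qed

text \<open>\<open>B\<close> is determined by \<open>R\<close>. It is a parameter so that the locale
  can be interpreted a second time with the colours exchanged, which turns red statements into blue
  ones.\<close>

locale two_colouring =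
  fixes R B :: "'a \<Rightarrow> 'a \<Rightarrow> bool"
  assumes red_sym: "R u v \<Longrightarrow> R v u"
    and red_irrefl: "\<not> R v v"
    and blue_iff: "B u v \<longleftrightarrow> u \<noteq> v \<and> \<not> R u v"
begin

lemma swap_colours: "two_colouring B R"
  using red_sym red_irrefl blue_iff by unfold_locales blast+

lemma clique_extend:
  assumes "v \<in> V" "has_clique R {u\<in>V. R v u} k"
  shows "has_clique R V (Suc k)"
proof -
  obtain K where K: "K \<subseteq> {u\<in>V. R v u}" "finite K" "card K = k"
      "\<forall>u\<in>K. \<forall>v\<in>K. u \<noteq> v \<longrightarrow> R u v"
    using assms(2) unfolding has_clique_def by blast
  have "v \<notin> K" using K red_irrefl by auto
  then show ?thesis
    unfolding has_clique_def
    using K assms(1) red_sym by (intro exI[of _ "insert v K"]) auto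
qed

lemma clique_join:
  assumes "S \<subseteq> X" "finite S" "\<forall>u\<in>S. \<forall>v\<in>S. u \<noteq> v \<longrightarrow> R u v"
    and "has_clique R {x\<in>X. \<forall>u\<in>S. R u x} k"
  shows "has_clique R X (card S + k)"
proof -
  obtain K where K: "K \<subseteq> {x\<in>X. \<forall>u\<in>S. R u x}" "finite K" "card K = k"
      "\<forall>u\<in>K. \<forall>v\<in>K. u \<noteq> v \<longrightarrow> R u v"
    using assms(4) unfolding has_clique_def by blast
  have "S \<inter> K = {}" using K(1) red_irrefl by auto
  then have "card (S \<union> K) = card S + k"
    using K assms by (simp add: card_Un_disjoint)
  moreover have "R u v" if "u \<in> S \<union> K" "v \<in> S \<union> K" "u \<noteq> v" for u v
    using that K(1,4) assms(3) red_sym by blast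
  moreover have "S \<union> K \<subseteq> X" using K(1) assms(1) by auto
  ultimately show ?thesis
    unfolding has_clique_def using K(2) assms(2) by (intro exI[of _ "S \<union> K"]) auto
qed

lemma card_neighbours:
  assumes "finite V" "v \<in> V"
  shows "card V = Suc (card {u\<in>V. R v u} + card {u\<in>V. B v u})"
proof -
  have "V = insert v ({u\<in>V. R v u} \<union> {u\<in>V. B v u})"
    using assms red_sym red_irrefl blue_iff by auto
  moreover have "card (insert v ({u\<in>V. R v u} \<union> {u\<in>V. B v u}))
      = Suc (card ({u\<in>V. R v u} \<union> {u\<in>V. B v u}))"
    using assms red_irrefl blue_iff by (subst card_insert_disjoint) auto
  moreover have "card ({u\<in>V. R v u} \<union> {u\<in>V. B v u}) = card {u\<in>V. R v u} + card {u\<in>V. B v u}"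
    using assms blue_iff by (intro card_Un_disjoint) auto
  ultimately show ?thesis by argo
qed

end

text \<open>The Erdos--Szekeres recursion. The binomial is shifted from
  \<open>(k + l - 2) choose (k - 1)\<close> so that Pascal's rule applies without subtraction of
  naturals; the loss is only polynomial.\<close>

lemma ramsey_binomial:
  assumes "two_colouring R B" "finite V" "(k + l) choose k \<le> card V"
  shows "has_clique R V k \<or> has_clique B V l"
  using assms(2,3)
proof (induction "k + l" arbitrary: k l V rule: less_induct)
  case less
  interpret two_colouring R B by fact
  interpret sw: two_colouring B R by (rule swap_colours)
  show ?case
  proof (cases "k = 0 \<or> l = 0")
    case False
    then obtain k' l' where kl: "k = Suc k'" "l = Suc l'" by (metis not0_implies_Suc)
    have "(k + l) choose k > 0" by simp
    then obtain v where v: "v \<in> V" using less.prems by fastforce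
    have "(k + l) choose k = ((k' + l) choose k') + ((k + l') choose k)"
      using kl by simp
    then have "(k' + l) choose k' \<le> card {u\<in>V. R v u} \<or> (k + l') choose k \<le> card {u\<in>V. B v u}"
      using card_neighbours[OF less.prems(1) v] less.prems(2) by linarith
    then show ?thesis
    proof
      assume "(k' + l) choose k' \<le> card {u\<in>V. R v u}"
      then have "has_clique R {u\<in>V. R v u} k' \<or> has_clique B {u\<in>V. R v u} l"
        using less.prems by (intro less.hyps) (auto simp: kl)
      then show ?thesis using clique_extend[OF v] has_clique_mono kl
        by (metis (no_types, lifting) mem_Collect_eq subsetI)
    next
      assume "(k + l') choose k \<le> card {u\<in>V. B v u}"
      then have "has_clique R {u\<in>V. B v u} k \<or> has_clique B {u\<in>V. B v u} l'"
        using less.prems by (intro less.hyps) (auto simp: kl)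
      then show ?thesis using sw.clique_extend[OF v] has_clique_mono kl
        by (metis (no_types, lifting) mem_Collect_eq subsetI)
    qed
  qed auto
qed

section \<open>Double counting and books\<close>

lemma sum_card_swap:
  assumes "finite A" "finite X"
  shows "(\<Sum>a\<in>A. card {x\<in>X. P a x}) = (\<Sum>x\<in>X. card {a\<in>A. P a x})"
proof -
  have "(\<Sum>a\<in>A. card {x\<in>X. P a x}) = (\<Sum>a\<in>A. \<Sum>x\<in>X. if P a x then 1 else 0)"
    using assms by (intro sum.cong refl) (simp add: sum.inter_filter[symmetric])
  also have "\<dots> = (\<Sum>x\<in>X. \<Sum>a\<in>A. if P a x then 1 else 0)" by (rule sum.swap)
  also have "\<dots> = (\<Sum>x\<in>X. card {a\<in>A. P a x})"
    using assms by (intro sum.cong refl) (simp add: sum.inter_filter[symmetric])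
  finally show ?thesis .
qed

text \<open>A repetition lies in the tail, or the head recurs in the tail; a tail of length
  \<open>b\<close> admits at most \<open>b\<close> such heads. Multiplying by \<open>card U\<close>
  rather than dividing keeps the count in the naturals.\<close>

lemma card_repeating_lists:
  assumes "finite U"
  shows "card {xs. set xs \<subseteq> U \<and> length xs = b \<and> \<not> distinct xs} * card U \<le> b^2 * card U ^ b"
proof (induction b)
  case (Suc b)
  let ?N = "{xs. set xs \<subseteq> U \<and> length xs = b \<and> \<not> distinct xs}"
  let ?L = "{xs. set xs \<subseteq> U \<and> length xs = b}"
  have finL: "finite ?L" using assms finite_lists_length_eq by blast
  then have finN: "finite ?N" by (rule rev_finite_subset) auto
  have finx: "finite {xs. set xs \<subseteq> U \<and> length xs = b \<and> x \<in> set xs}" for x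
    by (rule rev_finite_subset[OF finL]) auto
  have "{xs. set xs \<subseteq> U \<and> length xs = Suc b \<and> \<not> distinct xs}
      \<subseteq> (\<lambda>(x, xs). x # xs) ` (U \<times> ?N \<union> (SIGMA x:U. {xs\<in>?L. x \<in> set xs}))"
  proof
    fix ys assume ys: "ys \<in> {xs. set xs \<subseteq> U \<and> length xs = Suc b \<and> \<not> distinct xs}"
    then obtain x xs where "ys = x # xs" by (cases ys) auto
    then show "ys \<in> (\<lambda>(x, xs). x # xs) ` (U \<times> ?N \<union> (SIGMA x:U. {xs\<in>?L. x \<in> set xs}))"
      using ys by (intro image_eqI[of _ _ "(x, xs)"]) auto
  qed
  then have "card {xs. set xs \<subseteq> U \<and> length xs = Suc b \<and> \<not> distinct xs}
      \<le> card (U \<times> ?N \<union> (SIGMA x:U. {xs\<in>?L. x \<in> set xs}))"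
    using assms finN by (intro surj_card_le finite_UnI finite_SigmaI finite_cartesian_product) (auto intro: finx)
  also have "\<dots> \<le> card (U \<times> ?N) + card (SIGMA x:U. {xs\<in>?L. x \<in> set xs})"
    by (rule card_Un_le)
  also have "card (SIGMA x:U. {xs\<in>?L. x \<in> set xs}) = (\<Sum>x\<in>U. card {xs\<in>?L. x \<in> set xs})"
    using assms by (intro card_SigmaI) (auto intro: finx)
  also have "\<dots> = (\<Sum>xs\<in>?L. card {x\<in>U. x \<in> set xs})"
    using assms finL by (rule sum_card_swap)
  also have "\<dots> \<le> (\<Sum>xs\<in>?L. b)"
  proof (rule sum_mono)
    fix xs assume "xs \<in> ?L"
    then have "card {x\<in>U. x \<in> set xs} \<le> card (set xs)" by (intro card_mono) auto
    also have "\<dots> \<le> b" using \<open>xs \<in> ?L\<close> card_length by blast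
    finally show "card {x\<in>U. x \<in> set xs} \<le> b" .
  qed
  also have "\<dots> = b * card U ^ b" using assms by (simp add: card_lists_length_eq)
  finally have "card {xs. set xs \<subseteq> U \<and> length xs = Suc b \<and> \<not> distinct xs} * card U
      \<le> (card U * card ?N + b * card U ^ b) * card U"
    by (simp add: card_cartesian_product)
  also have "\<dots> = card U * (card ?N * card U) + b * card U ^ Suc b" by (simp add: algebra_simps)
  also have "\<dots> \<le> card U * (b^2 * card U ^ b) + b * card U ^ Suc b" using Suc by simp
  also have "\<dots> = (b^2 + b) * card U ^ Suc b" by (simp add: algebra_simps)
  also have "\<dots> \<le> (Suc b)^2 * card U ^ Suc b"
    by (intro mult_right_mono) (auto simp: power2_eq_square)
  finally show ?case .
qed simp

text \<open>A power mean inequality: sum the tangents of \<open>t ^ b\<close> at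
  \<open>t = c\<close>, that is, Bernoulli's inequality after scaling. Their slope is nonnegative,
  so an average above \<open>c\<close> only helps.\<close>

lemma sum_power_ge:
  fixes d :: "'a \<Rightarrow> real" and c :: real
  assumes "finite X" "\<And>x. x \<in> X \<Longrightarrow> d x \<ge> 0" "c > 0" "(\<Sum>x\<in>X. d x) \<ge> c * card X"
  shows "(\<Sum>x\<in>X. d x ^ b) \<ge> real (card X) * c ^ b"
proof -
  have "card X * c ^ b + c ^ b * b * ((\<Sum>x\<in>X. d x) / c - card X)
      = (\<Sum>x\<in>X. c ^ b * (1 + real b * (d x / c - 1)))"
    using assms(3)
    by (simp add: sum.distrib sum_distrib_left sum_subtractf sum_divide_distrib algebra_simps)
  also have "\<dots> \<le> (\<Sum>x\<in>X. d x ^ b)"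
  proof (rule sum_mono)
    fix x assume "x \<in> X"
    have "1 + real b * (d x / c - 1) \<le> (1 + (d x / c - 1)) ^ b"
      using assms(2)[OF \<open>x \<in> X\<close>] assms(3) by (intro Bernoulli_inequality) simp
    then have "c ^ b * (1 + real b * (d x / c - 1)) \<le> c ^ b * (d x / c) ^ b"
      using assms(3) by (intro mult_left_mono) auto
    then show "c ^ b * (1 + real b * (d x / c - 1)) \<le> d x ^ b"
      using assms(3) by (simp add: power_divide)
  qed
  finally have "card X * c ^ b + c ^ b * b * ((\<Sum>x\<in>X. d x) / c - card X) \<le> (\<Sum>x\<in>X. d x ^ b)" .
  moreover have "c ^ b * b * ((\<Sum>x\<in>X. d x) / c - card X) \<ge> 0"
    using assms(3,4) by (intro mult_nonneg_nonneg) (simp_all add: field_simps)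
  ultimately show ?thesis by linarith
qed

text \<open>Sampling the vertices of the book's spine from \<open>U\<close> with replacement makes the expected number
  of common neighbours a power mean, and a bounded spine has no repetition with high probability.\<close>

lemma exists_book:
  fixes \<mu> :: real
  assumes "finite X" "X \<noteq> {}" "finite U" "\<mu> > 0"
    and deg: "\<And>u. u \<in> U \<Longrightarrow> card {x\<in>X. P u x} \<ge> \<mu> * card X"
    and m: "2 * real b ^ 2 \<le> card U * \<mu> ^ b" "U \<noteq> {}"
  shows "\<exists>S\<subseteq>U. card S = b \<and> card {x\<in>X. \<forall>u\<in>S. P u x} \<ge> \<mu> ^ b * card X / 2"
proof (rule ccontr)
  assume "\<not> ?thesis"
  then have small: "card {x\<in>X. \<forall>u\<in>S. P u x} < \<mu> ^ b * card X / 2" if "S \<subseteq> U" "card S = b" for S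
    using that by force
  define L where "L = {xs. set xs \<subseteq> U \<and> length xs = b}"
  define D where "D = {xs\<in>L. distinct xs}"
  define N where "N = {xs\<in>L. \<not> distinct xs}"
  define m' where "m' = real (card U)"
  have m': "m' > 0" using m(2) assms(3) by (simp add: m'_def card_gt_0_iff)
  have n: "real (card X) > 0" using assms by (simp add: card_gt_0_iff)
  have finL: "finite L" unfolding L_def using assms finite_lists_length_eq by blast
  have LDN: "L = D \<union> N" "D \<inter> N = {}" "finite D" "finite N" using finL by (auto simp: D_def N_def)
  have cardL: "real (card L) = m' ^ b"
    using assms by (simp add: L_def card_lists_length_eq m'_def)
  have cN: "real (card N) \<le> m' ^ b * \<mu> ^ b / 2"
  proof -
    have "card N * card U \<le> b^2 * card U ^ b"
      using card_repeating_lists[OF assms(3), of b] by (simp add: N_def L_def conj_assoc)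
    then have "real (card N) * m' \<le> real b ^ 2 * m' ^ b"
      unfolding m'_def of_nat_mult[symmetric] of_nat_power[symmetric] of_nat_le_iff .
    also have "\<dots> \<le> (m' * \<mu> ^ b / 2) * m' ^ b"
      using m m' by (intro mult_right_mono) (auto simp: m'_def)
    finally have "real (card N) * m' \<le> (m' ^ b * \<mu> ^ b / 2) * m'" by (simp add: algebra_simps)
    then show ?thesis using m' mult_le_cancel_right_pos by blast
  qed
  define c where "c = (\<lambda>xs. card {x\<in>X. \<forall>u\<in>set xs. P u x})"
  have "(\<Sum>x\<in>X. real (card {u\<in>U. P u x})) = (\<Sum>u\<in>U. real (card {x\<in>X. P u x}))"
    unfolding of_nat_sum[symmetric] sum_card_swap[OF assms(3,1)] ..
  also have "\<dots> \<ge> (\<Sum>u\<in>U. \<mu> * real (card X))" by (intro sum_mono deg)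
  finally have "real (card X) * (m' * \<mu>) ^ b \<le> (\<Sum>x\<in>X. real (card {u\<in>U. P u x}) ^ b)"
    using assms m' by (intro sum_power_ge) (auto simp: m'_def algebra_simps)
  also have "\<dots> = (\<Sum>x\<in>X. real (card {xs\<in>L. \<forall>u\<in>set xs. P u x}))"
  proof (rule sum.cong[OF refl])
    fix x
    have "{xs\<in>L. \<forall>u\<in>set xs. P u x} = {xs. set xs \<subseteq> {u\<in>U. P u x} \<and> length xs = b}"
      by (auto simp: L_def)
    then show "real (card {u\<in>U. P u x}) ^ b = real (card {xs\<in>L. \<forall>u\<in>set xs. P u x})"
      using assms by (simp add: card_lists_length_eq)
  qed
  also have "\<dots> = (\<Sum>xs\<in>L. real (c xs))"
    unfolding c_def of_nat_sum[symmetric]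
    using sum_card_swap[OF finL assms(1), of "\<lambda>xs x. \<forall>u\<in>set xs. P u x"] by simp
  also have "\<dots> = (\<Sum>xs\<in>D. real (c xs)) + (\<Sum>xs\<in>N. real (c xs))"
    using LDN by (simp add: sum.union_disjoint)
  \<comment> \<open>Lists with a repetition get the trivial bound. By \<open>cN\<close> they use up
    at most half of the total, whence the factor 1/2 in the conclusion.\<close>
  also have "(\<Sum>xs\<in>N. real (c xs)) \<le> (\<Sum>xs\<in>N. real (card X))"
    using assms by (intro sum_mono) (auto simp: c_def intro!: card_mono)
  also have "(\<Sum>xs\<in>N. real (card X)) \<le> (m' ^ b * \<mu> ^ b / 2) * card X"
    using cN n by simp
  finally have *: "card X * (m' * \<mu>) ^ b \<le> (\<Sum>xs\<in>D. real (c xs)) + (m' ^ b * \<mu> ^ b / 2) * card X"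
    by simp
  have lt: "real (c xs) < \<mu> ^ b * card X / 2" if "xs \<in> D" for xs
    unfolding c_def using that by (intro small) (auto simp: D_def L_def distinct_card)
  have "(\<Sum>xs\<in>D. real (c xs)) < m' ^ b * (\<mu> ^ b * card X / 2)"
  proof (cases "D = {}")
    case True
    then show ?thesis using m' n assms by simp
  next
    case False
    then have "(\<Sum>xs\<in>D. real (c xs)) < (\<Sum>xs\<in>D. \<mu> ^ b * card X / 2)"
      using LDN lt by (intro sum_strict_mono) auto
    also have "\<dots> = card D * (\<mu> ^ b * card X / 2)" by simp
    also have "\<dots> \<le> card L * (\<mu> ^ b * card X / 2)"
      using n assms finL by (intro mult_right_mono) (auto simp: D_def intro!: card_mono)
    finally show ?thesis using cardL by simp
  qed
  then show False using * by (simp add: power_mult_distrib algebra_simps)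
qed

section \<open>Red excess over density p\<close>

definition excess :: "('a \<Rightarrow> 'a \<Rightarrow> bool) \<Rightarrow> real \<Rightarrow> 'a set \<Rightarrow> 'a set \<Rightarrow> real" where
  "excess R p X Y = (\<Sum>x\<in>X. \<Sum>y\<in>Y. (if R x y then 1 else 0) - p)"

lemma excess_vertex:
  assumes "finite Y"
  shows "excess R p {v} Y = real (card {y\<in>Y. R v y}) - p * real (card Y)"
  using assms by (simp add: excess_def sum_subtractf sum.inter_filter[symmetric])

lemma excess_sum: "excess R p X Y = (\<Sum>v\<in>X. excess R p {v} Y)"
  by (simp add: excess_def)

text \<open>For the sake of this additivity the excess is not normalised: it splits over a vertex of
  \<open>X\<close> and the red and blue parts of the rest. The density excess is its quotient by
  \<open>card X * card Y\<close>.\<close>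

lemma excess_Un:
  "finite X \<Longrightarrow> finite X' \<Longrightarrow> X \<inter> X' = {} \<Longrightarrow> excess R p (X \<union> X') Y = excess R p X Y + excess R p X' Y"
  unfolding excess_def by (rule sum.union_disjoint)

lemma excess_le:
  assumes "finite X" "finite Y" "0 \<le> p"
  shows "excess R p X Y \<le> card X * card Y"
proof -
  have "excess R p X Y \<le> (\<Sum>x\<in>X. \<Sum>y\<in>Y. 1)"
    unfolding excess_def using assms by (intro sum_mono) auto
  then show ?thesis by simp
qed

text \<open>Cauchy--Schwarz: the red neighbourhoods of a weighted random vertex of \<open>X\<close> do not decrease the
  red density.\<close>

lemma excess_neighbourhoods:
  assumes "finite X" "finite Y"
  shows "(\<Sum>v\<in>X. excess R p X {y\<in>Y. R v y}) * card Y
    \<ge> excess R p X Y * (\<Sum>v\<in>X. card {y\<in>Y. R v y})"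
proof -
  define d where "d = (\<lambda>y. real (card {x\<in>X. R x y}))"
  define e where "e = (\<Sum>y\<in>Y. d y)"
  have ex: "excess R p X Y' = (\<Sum>y\<in>Y'. d y - p * card X)" for Y'
    unfolding excess_def using assms
    by (subst sum.swap) (simp add: sum_subtractf sum.inter_filter[symmetric] d_def)
  have "(\<Sum>v\<in>X. excess R p X {y\<in>Y. R v y}) = (\<Sum>v\<in>X. \<Sum>y\<in>Y. if R v y then d y - p * card X else 0)"
    unfolding ex using assms by (simp add: sum.inter_filter)
  also have "\<dots> = (\<Sum>y\<in>Y. \<Sum>v\<in>X. if R v y then d y - p * card X else 0)" by (rule sum.swap)
  also have "\<dots> = (\<Sum>y\<in>Y. d y * (d y - p * card X))"
    using assms by (simp add: sum.inter_filter[symmetric] d_def)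
  also have "\<dots> = (\<Sum>y\<in>Y. d y ^ 2) - p * card X * e"
    by (simp add: power2_eq_square algebra_simps sum_subtractf sum_distrib_left sum_distrib_right
        e_def)
  finally have 1: "(\<Sum>v\<in>X. excess R p X {y\<in>Y. R v y}) = (\<Sum>y\<in>Y. d y ^ 2) - p * card X * e" .
  have 2: "excess R p X Y = e - p * card X * card Y" by (simp add: ex sum_subtractf e_def)
  have 3: "(\<Sum>v\<in>X. card {y\<in>Y. R v y}) = e"
    unfolding sum_card_swap[OF assms] e_def d_def by simp
  have "e ^ 2 \<le> (\<Sum>y\<in>Y. d y ^ 2) * card Y"
    unfolding e_def using sum_squared_le_sum_of_squares[of d Y] .
  then show ?thesis unfolding 1 2 3 by (simp add: algebra_simps power2_eq_square)
qed

section \<open>The potential of a pair of vertex sets\<close>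

text \<open>Up to the constant \<open>exp (c / K)\<close>, the left side is the concave function
  \<open>r powr (1 - 1 / K)\<close> and the right side its tangent at \<open>r0\<close>; weighted
  AM-GM proves it. At \<open>r = 0\<close> the factor \<open>r\<close> makes the value of
  \<open>ln 0\<close> irrelevant.\<close>

lemma scaled_powr_tangent:
  fixes r r0 c K :: real
  assumes "r \<ge> 0" "r0 > 0" "K \<ge> 1"
  shows "r * exp ((c - ln r) / K) \<le> exp ((c - ln r0) / K) * (r0 + (1 - 1 / K) * (r - r0))"
proof (cases "r = 0")
  case True
  have "r0 + (1 - 1 / K) * (r - r0) = r0 / K" using True by (simp add: algebra_simps)
  then show ?thesis using True assms by simp
next
  case False
  then have r: "r > 0" using assms by simp
  have "r powr (1 - 1 / K) * r0 powr (1 / K) \<le> (1 - 1 / K) * r + (1 / K) * r0"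
    using r assms by (intro Youngs_inequality_0) auto
  then have 1: "r powr (1 - 1 / K) * r0 powr (1 / K) \<le> r0 + (1 - 1 / K) * (r - r0)"
    by (simp add: algebra_simps diff_divide_distrib)
  have "r powr (1 - 1 / K) * r0 powr (1 / K) = exp (ln r + (ln r0 - ln r) / K)"
    using r assms(2) by (simp add: powr_def exp_add[symmetric] algebra_simps diff_divide_distrib)
  also have "\<dots> = r * exp ((ln r0 - ln r) / K)" using r by (simp add: exp_add)
  finally have 2: "r * exp ((ln r0 - ln r) / K) \<le> r0 + (1 - 1 / K) * (r - r0)" using 1 by simp
  have "r * exp ((c - ln r) / K) = exp ((c - ln r0) / K) * (r * exp ((ln r0 - ln r) / K))"
    by (simp add: mult_exp_exp add_divide_distrib[symmetric])
  also have "\<dots> \<le> exp ((c - ln r0) / K) * (r0 + (1 - 1 / K) * (r - r0))"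
    using 2 by (rule mult_left_mono) simp
  finally show ?thesis .
qed

text \<open>The fractions \<open>r\<close> and \<open>x\<close> are the relative red and blue degrees of the chosen vertex. The two
  exponentials are the largest relative excesses for which neither colour yields a contradiction; their
  sum is largest at \<open>x = \<mu>\<close>, \<open>r = 1 - \<mu>\<close>, which dictates the value of \<open>A\<close>.\<close>

lemma step_inequality:
  fixes r x \<mu> q A C K u :: real
  assumes "0 < \<mu>" "\<mu> < 1" "q \<ge> 0" "K \<ge> 1" "r \<ge> 0" "x \<ge> 0" "r + x \<le> 1" "x \<le> \<mu>"
    and u: "u = q / ((1 - \<mu>) * K)" "u \<le> 1"
    and A: "A \<ge> q / (1 - \<mu>) - ln (1 - \<mu>)" and C: "C \<ge> - ln \<mu>"
  shows "r * exp ((q - A - ln r) / K) + x * exp ((q - C - ln x) / K) \<le> 1 + u^2"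
proof -
  define r0 where "r0 = 1 - \<mu>"
  define P where "P = exp (- u * \<mu>)"
  define Q where "Q = exp (u * r0)"
  define s where "s = 1 - 1 / K"
  have r0: "r0 > 0" using assms by (simp add: r0_def)
  have s: "0 \<le> s" "s \<le> 1" using assms by (auto simp: s_def)
  have u0: "u \<ge> 0" using assms r0 by (simp add: r0_def)
  have uK: "u * K = q / r0" using assms(4) r0 unfolding u(1) r0_def by simp
  then have uK': "u * r0 * K = q" using r0 by (simp add: field_simps)
  have "(q - A - ln r0) / K \<le> - u * \<mu>"
  proof -
    have "q - A - ln r0 \<le> q - q / r0" using A by (simp add: r0_def)
    also have "\<dots> = u * r0 * K - u * K" using uK uK' by simp
    also have "\<dots> = - u * \<mu> * K" by (simp add: r0_def algebra_simps)
    finally show ?thesis using assms(4) by (simp add: pos_divide_le_eq)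
  qed
  then have P: "exp ((q - A - ln r0) / K) \<le> P" by (simp add: P_def)
  have "q - C - ln \<mu> \<le> u * r0 * K" using C uK' by simp
  then have Q: "exp ((q - C - ln \<mu>) / K) \<le> Q" using assms(4) by (simp add: Q_def pos_divide_le_eq)
  have "- u * \<mu> \<le> u * r0" using u0 by (simp add: r0_def algebra_simps)
  then have PQ: "P \<le> Q" by (simp add: P_def Q_def)
  have nn1: "r0 + s * (r - r0) \<ge> 0" and nn2: "\<mu> + s * (x - \<mu>) \<ge> 0"
  proof -
    have "r0 + s * (r - r0) = (1 - s) * r0 + s * r" "\<mu> + s * (x - \<mu>) = (1 - s) * \<mu> + s * x"
      by (simp_all add: algebra_simps)
    then show "r0 + s * (r - r0) \<ge> 0" "\<mu> + s * (x - \<mu>) \<ge> 0" using s r0 assms by auto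
  qed
  have "r * exp ((q - A - ln r) / K) \<le> exp ((q - A - ln r0) / K) * (r0 + s * (r - r0))"
    using scaled_powr_tangent[of r r0 K "q - A"] assms r0 by (simp add: s_def)
  also have "\<dots> \<le> P * (r0 + s * (r - r0))" using P nn1 by (rule mult_right_mono)
  also have "\<dots> \<le> P * (r0 + s * (\<mu> - x))"
    using s assms by (intro mult_left_mono add_mono) (auto simp: P_def r0_def intro!: mult_left_mono)
  finally have 1: "r * exp ((q - A - ln r) / K) \<le> P * (r0 + s * (\<mu> - x))" .
  have "x * exp ((q - C - ln x) / K) \<le> exp ((q - C - ln \<mu>) / K) * (\<mu> + s * (x - \<mu>))"
    using scaled_powr_tangent[of x \<mu> K "q - C"] assms by (simp add: s_def)
  also have "\<dots> \<le> Q * (\<mu> + s * (x - \<mu>))" using Q nn2 by (rule mult_right_mono)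
  finally have 2: "x * exp ((q - C - ln x) / K) \<le> Q * (\<mu> + s * (x - \<mu>))" .
  \<comment> \<open>Because \<open>P \<le> Q\<close> and \<open>x \<le> \<mu>\<close>, moving weight
    from the red to the blue part only increases the sum, so \<open>x = \<mu>\<close> is the worst
    case. There the first-order terms \<open>- u * \<mu> * r0\<close> and
    \<open>u * r0 * \<mu>\<close> cancel, and an error of order \<open>u^2\<close> remains.\<close>
  have "P * (s * (\<mu> - x)) \<le> Q * (s * (\<mu> - x))" using PQ s assms by (intro mult_right_mono) auto
  then have "P * (r0 + s * (\<mu> - x)) + Q * (\<mu> + s * (x - \<mu>)) \<le> P * r0 + Q * \<mu>"
    by (simp add: algebra_simps)
  also have "P * r0 + Q * \<mu> \<le> (1 - u * \<mu> + (u * \<mu>)^2) * r0 + (1 + u * r0 + (u * r0)^2) * \<mu>"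
  proof (intro add_mono mult_right_mono)
    have um: "u * \<mu> \<ge> 0" "u * r0 \<ge> 0" using u0 r0 assms by auto
    have "u * r0 \<le> 1 * 1" using u0 u(2) r0 assms by (intro mult_mono) (auto simp: r0_def)
    then show "Q \<le> 1 + u * r0 + (u * r0)^2" unfolding Q_def using um by (intro exp_bound) auto
    have "u * \<mu> \<le> 1 * 1" using u0 u(2) assms by (intro mult_mono) auto
    have "P * (1 + u * \<mu>) \<le> P * exp (u * \<mu>)" by (intro mult_left_mono) (auto simp: P_def)
    also have "\<dots> = 1" by (simp add: P_def exp_add[symmetric])
    finally have "P * (1 + u * \<mu>) \<le> 1" .
    also have "1 \<le> (1 - u * \<mu> + (u * \<mu>)^2) * (1 + u * \<mu>)"
    proof -
      have "(1 - z + z^2) * (1 + z) = 1 + z^3" for z :: real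
        by (simp add: power2_eq_square power3_eq_cube algebra_simps)
      then show ?thesis using zero_le_power[OF um(1), of 3] by simp
    qed
    finally show "P \<le> 1 - u * \<mu> + (u * \<mu>)^2" using um by (simp add: mult_le_cancel_right)
  qed (use r0 assms in auto)
  also have "\<dots> = 1 + u^2 * (\<mu>^2 * r0 + r0^2 * \<mu>)"
    by (simp add: r0_def power2_eq_square algebra_simps)
  also have "\<dots> \<le> 1 + u^2 * 1"
  proof -
    have "\<mu>^2 * r0 + r0^2 * \<mu> = \<mu> * r0" by (simp add: r0_def power2_eq_square algebra_simps)
    also have "\<dots> \<le> 1 * 1" using assms r0 by (intro mult_mono) (auto simp: r0_def)
    finally show ?thesis by (intro add_left_mono mult_left_mono) auto
  qed
  finally show ?thesis using 1 2 by simp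
qed

text \<open>The logarithm of the potential, meaningful only for positive excess; statements about it
  therefore carry that condition.\<close>

definition pot :: "('a \<Rightarrow> 'a \<Rightarrow> bool) \<Rightarrow> real \<Rightarrow> nat \<Rightarrow> 'a set \<Rightarrow> 'a set \<Rightarrow> real" where
  "pot R p K X Y = ln (card X) + ln (card Y) + K * ln (excess R p X Y / (card X * card Y))"

lemma excess_pos_nonempty:
  assumes "excess R p X Y > 0" "finite X" "finite Y"
  shows "card X > 0" "card Y > 0"
proof -
  have "X \<noteq> {}" "Y \<noteq> {}" using assms(1) by (auto simp: excess_def)
  then show "card X > 0" "card Y > 0" using assms by (simp_all add: card_gt_0_iff)
qed

text \<open>A vertex set of maximal potential is almost regular towards \<open>Y\<close>.\<close>

lemma pot_remove:
  fixes p :: real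
  assumes fin: "finite X" "finite Y" and "v \<in> X" "K \<ge> 1" and pos: "excess R p X Y > 0"
    and low: "excess R p {v} Y < (1 - 1 / K) * (excess R p X Y / card X)"
  shows "excess R p (X - {v}) Y > 0" "pot R p K X Y \<le> pot R p K (X - {v}) Y"
proof -
  define e where "e = excess R p X Y"
  define e' where "e' = excess R p (X - {v}) Y"
  define n where "n = real (card (X - {v}))"
  have ee: "e = e' + excess R p {v} Y"
    using excess_Un[of "X - {v}" "{v}" R p Y] assms by (simp add: e_def e'_def insert_absorb)
  have cX: "real (card X) = n + 1" using card.remove[OF fin(1) assms(3)] by (simp add: n_def)
  have cY: "real (card Y) > 0" using excess_pos_nonempty[OF pos fin] by simp
  have e: "e > 0" using pos by (simp add: e_def)
  have K: "real K > 0" using assms by simp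
  have n0: "n > 0"
  proof (rule ccontr)
    assume "\<not> n > 0"
    then have "n = 0" by (simp add: n_def)
    then have "X - {v} = {}" using fin unfolding n_def by (metis card_0_eq finite_Diff of_nat_eq_0_iff)
    then have "e' = 0" unfolding e'_def excess_def by (simp only: sum.empty)
    then have "e < (1 - 1 / K) * e" using low ee cX \<open>n = 0\<close> by (simp add: e_def)
    then show False using e K by (simp add: field_simps)
  qed
  have low': "excess R p {v} Y < (1 - 1 / K) * (e / (n + 1))" using low cX by (simp add: e_def)
  have e': "e' \<ge> e * (n + 1 / K) / (n + 1)"
  proof -
    have "e' \<ge> e - (1 - 1 / K) * (e / (n + 1))" using low' ee by simp
    also have "e - (1 - c) * (e / (n + 1)) = e * (n + c) / (n + 1)" for c
      using n0 by (simp add: field_simps)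
    finally show ?thesis .
  qed
  have "e * (n + 1 / K) / (n + 1) > 0" using e n0 K by (simp add: add_pos_pos)
  then have e'0: "e' > 0" using e' by simp
  then show "excess R p (X - {v}) Y > 0" by (simp add: e'_def)
  define t where "t = e / ((n + 1) * card Y)"
  have t: "t > 0" using e n0 cY by (simp add: t_def)
  have "t * (1 + 1 / (n * K)) = (e * (n + 1 / K) / (n + 1)) / (n * card Y)"
    using n0 K cY by (simp add: t_def field_simps)
  also have "\<dots> \<le> e' / (n * card Y)" using e' n0 cY by (intro divide_right_mono) auto
  finally have t': "t * (1 + 1 / (n * K)) \<le> e' / (n * card Y)" .
  have "0 \<le> 1 / (n * K)" using n0 by simp
  then have "- 1 \<le> 1 / (n * K)" by linarith
  \<comment> \<open>Deleting \<open>v\<close> multiplies \<open>card X\<close> by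
    \<open>n / (n + 1)\<close> and the density excess by at least \<open>1 + 1 / (n * K)\<close>,
    whose \<open>K\<close>-th power makes up for the loss. This balance fixes the tolerance
    \<open>1 - 1 / K\<close>.\<close>
  then have "1 + K * (1 / (n * K)) \<le> (1 + 1 / (n * K)) ^ K" by (rule Bernoulli_inequality)
  then have "ln ((n + 1) / n) \<le> ln ((1 + 1 / (n * K)) ^ K)"
    using n0 K by (intro ln_mono) (simp_all add: add_divide_distrib add_pos_pos)
  also have "\<dots> = K * ln (1 + 1 / (n * K))" by (rule ln_realpow)
  finally have "ln (n + 1) \<le> ln n + K * ln (1 + 1 / (n * K))" using n0 by (simp add: ln_div)
  moreover have "ln t + ln (1 + 1 / (n * K)) \<le> ln (e' / (n * card Y))"
  proof -
    have "ln t + ln (1 + 1 / (n * K)) = ln (t * (1 + 1 / (n * K)))"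
      using t n0 K by (intro ln_mult_pos[symmetric]) (auto simp: add_pos_pos)
    also have "\<dots> \<le> ln (e' / (n * card Y))"
      using t' t n0 K by (intro ln_mono) (auto simp: add_pos_pos)
    finally show ?thesis .
  qed
  then have "K * (ln t + ln (1 + 1 / (n * K))) \<le> K * ln (e' / (n * card Y))"
    by (intro mult_left_mono) auto
  ultimately have "ln (n + 1) + K * ln t \<le> ln n + K * ln (e' / (n * card Y))"
    by (simp add: algebra_simps)
  then show "pot R p K X Y \<le> pot R p K (X - {v}) Y"
    by (simp add: pot_def cX t_def e_def e'_def n_def)
qed

text \<open>Averaging in \<open>excess_neighbourhoods\<close>. Were all vertices outside
  \<open>W\<close> bad, those in \<open>W\<close> would have to supply the missing share
  \<open>\<kappa>\<close> of the total. Each supplies at most \<open>card X * card Y\<close>, which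
  is too little, since by \<open>reg\<close> all red degrees are at least \<open>p * card Y\<close>
  and the total is large.\<close>

lemma exists_good_vertex:
  fixes p \<theta> \<kappa> :: real
  assumes fin: "finite X" "finite Y" and p: "0 < p" and pos: "excess R p X Y > 0"
    and reg: "\<And>v. v \<in> X \<Longrightarrow> excess R p {v} Y \<ge> 0"
    and \<theta>: "\<theta> = excess R p X Y / (card X * card Y)"
    and \<kappa>: "\<kappa> > 0" "\<kappa> \<le> 1" and W: "W \<subseteq> X" "card W < \<kappa> * \<theta> * p * card X"
  shows "\<exists>v\<in>X - W. excess R p X {y\<in>Y. R v y} \<ge> (1 - \<kappa>) * \<theta> * card X * card {y\<in>Y. R v y}"
proof (rule ccontr)
  assume "\<not> ?thesis"
  then have bad: "excess R p X {y\<in>Y. R v y} \<le> (1 - \<kappa>) * \<theta> * card X * card {y\<in>Y. R v y}"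
    if "v \<in> X - W" for v using that by force
  define d where "d = (\<lambda>v. real (card {y\<in>Y. R v y}))"
  define D where "D = (\<Sum>v\<in>X. d v)"
  have c: "real (card X) > 0" "real (card Y) > 0" using excess_pos_nonempty[OF pos fin] by auto
  have \<theta>0: "\<theta> > 0" using pos c by (simp add: \<theta>)
  have "D \<ge> (\<Sum>v\<in>X. p * card Y)"
    unfolding D_def using reg fin by (intro sum_mono) (simp add: excess_vertex d_def)
  then have D: "D \<ge> p * card X * card Y" by (simp add: algebra_simps)
  have "excess R p X Y * D \<le> (\<Sum>v\<in>X. excess R p X {y\<in>Y. R v y}) * card Y"
    using excess_neighbourhoods[OF fin, of R p] by (simp add: D_def d_def)
  then have "\<theta> * card X * D \<le> (\<Sum>v\<in>X. excess R p X {y\<in>Y. R v y})"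
    using c by (simp add: \<theta> field_simps)
  also have "\<dots> \<le> (\<Sum>v\<in>X. (1 - \<kappa>) * \<theta> * card X * d v + (if v \<in> W then real (card X * card Y) else 0))"
  proof (rule sum_mono)
    fix v assume v: "v \<in> X"
    show "excess R p X {y\<in>Y. R v y}
      \<le> (1 - \<kappa>) * \<theta> * card X * d v + (if v \<in> W then real (card X * card Y) else 0)"
    proof (cases "v \<in> W")
      case True
      have "excess R p X {y\<in>Y. R v y} \<le> real (card X * card {y\<in>Y. R v y})"
        using excess_le[of X "{y\<in>Y. R v y}" p R] fin p by simp
      also have "\<dots> \<le> real (card X * card Y)"
        using fin by (intro of_nat_mono mult_left_mono card_mono) auto
      moreover have "(1 - \<kappa>) * \<theta> * card X * d v \<ge> 0"
        using \<kappa> \<theta>0 by (auto simp: d_def)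
      ultimately show ?thesis using True by simp
    qed (use v bad d_def in auto)
  qed
  also have "\<dots> = (1 - \<kappa>) * \<theta> * card X * D + (\<Sum>v\<in>X. if v \<in> W then real (card X * card Y) else 0)"
    by (simp add: sum.distrib D_def sum_distrib_left)
  also have "(\<Sum>v\<in>X. if v \<in> W then real (card X * card Y) else 0) = card W * (card X * card Y)"
    using fin W(1) by (simp add: sum.inter_restrict[symmetric] Int_absorb1)
  finally have "card X * (\<kappa> * \<theta> * D) \<le> card X * (card W * card Y)" by (simp add: algebra_simps)
  then have "\<kappa> * \<theta> * D \<le> card W * card Y" using c by (simp add: mult_le_cancel_left)
  moreover have "\<kappa> * \<theta> * (p * card X * card Y) \<le> \<kappa> * \<theta> * D"
    using D \<kappa> \<theta>0 by (intro mult_left_mono) auto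
  ultimately have "(\<kappa> * \<theta> * p * card X) * card Y \<le> card W * card Y" by (simp add: algebra_simps)
  then show False using W(2) c by (simp add: mult_le_cancel_right)
qed

section \<open>The recursion on the potential\<close>

context two_colouring
begin

text \<open>Here \<open>k'\<close> and \<open>l'\<close> are the sizes still forbidden to red
  cliques in \<open>X \<union> Y\<close> and to blue cliques in \<open>X\<close>. A red step lowers
  \<open>k'\<close>; a blue step lowers \<open>l'\<close>, for \<open>X\<close> alone, so
  \<open>Y\<close> keeps \<open>l\<close>. The prices are \<open>A\<close> and \<open>C\<close>, and
  \<open>\<eta>\<close> per step pays for all errors. \<open>Xm\<close> is the size below which
  \<open>X\<close> counts as exhausted; above it, the exceptional vertices of large blue degree and
  the chosen vertex itself are negligible.\<close>

lemma pot_bound: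
  fixes p \<mu> A C \<eta> a Z0 N \<tau> Xm q :: real and K k l m b :: nat
  assumes K: "2 \<le> K" and p: "0 < p" "p < 1" and \<mu>: "0 < \<mu>" "\<mu> < 1"
    and q: "q = - ln p" and \<eta>: "\<eta> > 0"
    and b: "3 \<le> \<eta> * b" and m: "2 * real b ^ 2 \<le> m * \<mu> ^ b"
    and A: "A \<ge> q / (1 - \<mu>) - ln (1 - \<mu>)" "a \<le> A" "0 \<le> A"
    and C: "C \<ge> - ln \<mu>"
    and KD: "(q / (1 - \<mu>))^2 + 4 < \<eta> * K" "q / (1 - \<mu>) \<le> K"
    and N: "1 \<le> N" and \<tau>: "0 < \<tau>" "\<tau> \<le> 1" "K * ln \<tau> \<le> - 2 * ln N"
    and Xm: "real ((k + m) choose k) * real K^2 / (\<tau> * p) \<le> Xm"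
    and V: "finite V" "card V \<le> N"
    and Z0: "0 \<le> Z0"
    and Ybound: "\<And>Y k'. Y \<subseteq> V \<Longrightarrow> Y \<noteq> {} \<Longrightarrow> k' \<le> k \<Longrightarrow> \<not> has_clique R Y k' \<Longrightarrow> \<not> has_clique B Y l
        \<Longrightarrow> ln (card Y) \<le> a * k' + Z0"
    and XY: "X \<subseteq> V" "Y \<subseteq> V" "k' \<le> k" "excess R p X Y > 0"
      "\<not> has_clique R (X \<union> Y) k'" "\<not> has_clique B X l'" "\<not> has_clique B Y l"
  shows "pot R p K X Y \<le> A * k' + C * l' + \<eta> * (real k' + real l') + ln Xm + Z0"
  using XY
proof (induction "card X" arbitrary: X Y k' l' rule: less_induct)
  case less
  interpret sw: two_colouring B R by (rule swap_colours)
  have fin: "finite X" "finite Y" using less.prems V finite_subset by blast+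
  define cX where "cX = real (card X)"
  define cY where "cY = real (card Y)"
  define e where "e = excess R p X Y"
  define \<theta> where "\<theta> = e / (cX * cY)"
  define RHS where "RHS = A * k' + C * l' + \<eta> * (real k' + real l') + ln Xm + Z0"
  have e: "e > 0" using less.prems by (simp add: e_def)
  have c: "cX \<ge> 1" "cY \<ge> 1"
    using excess_pos_nonempty[OF less.prems(4) fin] by (simp_all add: cX_def cY_def)
  have \<theta>: "\<theta> > 0" using e c by (simp add: \<theta>_def)
  have "e \<le> cX * cY" using excess_le[OF fin, of p R] p by (simp add: e_def cX_def cY_def)
  then have \<theta>1: "\<theta> \<le> 1" using c by (simp add: \<theta>_def)
  have pot: "pot R p K X Y = ln cX + ln cY + K * ln \<theta>"
    by (simp add: pot_def cX_def cY_def \<theta>_def e_def)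
  have K1: "real K \<ge> 2" using K by simp
  have C0: "0 \<le> C" using C \<mu> ln_le_zero_iff[of \<mu>] by linarith
  have choose1: "real ((k + m) choose k) \<ge> 1" by (simp add: Suc_leI)
  have Kp: "real K ^ 2 / (\<tau> * p) \<le> Xm"
  proof -
    have "1 * (real K ^ 2 / (\<tau> * p)) \<le> real ((k + m) choose k) * (real K^2 / (\<tau> * p))"
      using choose1 \<tau> p by (intro mult_right_mono) auto
    then show ?thesis using Xm by simp
  qed
  have Kt: "real K ^ 2 / \<tau> \<le> Xm"
  proof -
    have "real K ^ 2 / \<tau> \<le> real K ^ 2 / (\<tau> * p)"
      using \<tau> p by (intro divide_left_mono) (auto simp: mult_le_cancel_left1)
    then show ?thesis using Kp by simp
  qed
  have Xm1: "Xm \<ge> 1"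
  proof -
    have "1 \<le> real K ^ 2" using K1 by (intro one_le_power) simp
    also have "\<dots> \<le> real K ^ 2 / \<tau>" using divide_left_mono[of \<tau> 1 "real K ^ 2"] \<tau> by simp
    finally show ?thesis using Kt by simp
  qed
  have RHS0: "RHS \<ge> 0" using A C0 \<eta> Xm1 Z0 by (simp add: RHS_def)
  have cN: "cX \<le> N" "cY \<le> N"
    using card_mono[OF V(1) less.prems(1)] card_mono[OF V(1) less.prems(2)] V(2)
    by (auto simp: cX_def cY_def)
  have IH: "pot R p K X' Y' \<le> A * k'' + C * l'' + \<eta> * (real k'' + real l'') + ln Xm + Z0"
    if "X' \<subset> X" "Y' \<subseteq> Y" "k'' \<le> k'" "excess R p X' Y' > 0" "\<not> has_clique R (X' \<union> Y') k''"
      "\<not> has_clique B X' l''" for X' Y' k'' l''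
  proof (rule less.hyps)
    show "card X' < card X" using that fin psubset_card_mono by blast
    show "\<not> has_clique B Y' l" using less.prems(7) that(2) has_clique_mono by blast
  qed (use that less.prems in auto)
  show ?case
  proof (rule ccontr)
    assume "\<not> ?thesis"
    then have big: "ln cX + ln cY + K * ln \<theta> > RHS" by (simp add: pot RHS_def)
    \<comment> \<open>\<open>\<tau>\<close> is such that below it the term
      \<open>K * ln \<theta>\<close> outweighs both \<open>ln cX\<close> and
      \<open>ln cY\<close>.\<close>
    have \<theta>\<tau>: "\<theta> > \<tau>"
    proof (rule ccontr)
      assume "\<not> \<theta> > \<tau>"
      then have "K * ln \<theta> \<le> K * ln \<tau>" using \<theta> by (intro mult_left_mono ln_mono) auto
      moreover have "ln cX \<le> ln N" "ln cY \<le> ln N" using cN c by (auto intro!: ln_mono)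
      ultimately show False using \<tau>(3) big RHS0 by linarith
    qed
    \<comment> \<open>If \<open>X\<close> is exhausted, \<open>Ybound\<close> finishes: its term
      \<open>a * k'\<close> is covered by the unspent \<open>A * k'\<close>.\<close>
    have cXm: "cX > Xm"
    proof (rule ccontr)
      assume "\<not> cX > Xm"
      then have "ln cX \<le> ln Xm" using c by (intro ln_mono) auto
      moreover have "Y \<noteq> {}" using c by (auto simp: cY_def)
      then have "ln cY \<le> a * k' + Z0"
        unfolding cY_def using less.prems has_clique_mono[of R Y k' "X \<union> Y"]
        by (intro Ybound) auto
      moreover have "a * k' \<le> A * k'" using A by (intro mult_right_mono) auto
      moreover have "K * ln \<theta> \<le> 0" using \<theta> \<theta>1 by (simp add: mult_nonneg_nonpos)
      moreover have "C * l' \<ge> 0" "\<eta> * (real k' + real l') \<ge> 0" using C0 \<eta> by auto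
      ultimately show False using big unfolding RHS_def by linarith
    qed
    \<comment> \<open>An irregular vertex can be deleted with \<open>k'\<close> and
      \<open>l'\<close> unchanged, since the induction runs on \<open>card X\<close>.\<close>
    have reg: "excess R p {v} Y \<ge> (1 - 1 / K) * (e / cX)" if v: "v \<in> X" for v
    proof (rule ccontr)
      assume "\<not> ?thesis"
      then have low: "excess R p {v} Y < (1 - 1 / K) * (excess R p X Y / card X)"
        by (simp add: e_def cX_def)
      have "1 \<le> K" using K by simp
      note r = pot_remove[OF fin v this less.prems(4) low]
      have "\<not> has_clique R ((X - {v}) \<union> Y) k'" "\<not> has_clique B (X - {v}) l'"
        using less.prems(5,6) has_clique_mono[of R "(X - {v}) \<union> Y" k' "X \<union> Y"]
          has_clique_mono[of B "X - {v}" l' X] by auto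
      then have "pot R p K (X - {v}) Y \<le> RHS"
        unfolding RHS_def using v r by (intro IH) auto
      then show False using r big pot by simp
    qed
    have K2: "1 - 1 / K \<ge> 1 / 2" using K1 by (simp add: field_simps)
    have ecX: "e / cX = \<theta> * cY" using c by (simp add: \<theta>_def)
    have reg0: "excess R p {v} Y \<ge> 0" if "v \<in> X" for v
    proof -
      have "0 \<le> (1 - 1 / K) * (e / cX)" using K2 e c by simp
      then show ?thesis using reg[OF that] by linarith
    qed
    define W where "W = {v\<in>X. card {x\<in>X. B v x} \<ge> \<mu> * cX}"
    have WX: "W \<subseteq> X" by (auto simp: W_def)
    have finW: "finite W" using WX fin finite_subset by blast
    \<comment> \<open>If \<open>W\<close> is large, it contains a blue clique of size
      \<open>m\<close>, hence a blue book whose spine has bounded size \<open>b\<close>. Each spine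
      vertex costs \<open>- ln \<mu> \<le> C\<close>, and by \<open>reg\<close> the pages
      \<open>T\<close> keep almost the whole density towards \<open>Y\<close>.\<close>
    have cardW: "card W < (k + m) choose k"
    proof (rule ccontr)
      assume "\<not> ?thesis"
      moreover have "(k' + m) choose k' \<le> (k + m) choose k"
      proof -
        have "(k' + m) choose k' = (k' + m) choose m" "(k + m) choose k = (k + m) choose m"
          using binomial_symmetric[of k' "k' + m"] binomial_symmetric[of k "k + m"] by auto
        then show ?thesis using less.prems(3) binomial_right_mono by simp
      qed
      ultimately have "(k' + m) choose k' \<le> card W" by linarith
      then have "has_clique R W k' \<or> has_clique B W m"
        using ramsey_binomial[OF two_colouring_axioms finW] by blast
      moreover have "\<not> has_clique R W k'"
        using less.prems(5) WX has_clique_mono[of R W k' "X \<union> Y"] by blast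
      ultimately obtain U where U: "U \<subseteq> W" "finite U" "card U = m"
          "\<forall>u\<in>U. \<forall>v\<in>U. u \<noteq> v \<longrightarrow> B u v"
        unfolding has_clique_def by blast
      have b0: "b > 0" using b by (intro gr0I) auto
      have "m > 0" using m b0 by (intro gr0I) auto
      then have U0: "U \<noteq> {}" using U(3) by auto
      have "\<exists>S\<subseteq>U. card S = b \<and> card {x\<in>X. \<forall>u\<in>S. B u x} \<ge> \<mu> ^ b * card X / 2"
        using fin U m U0 \<mu> c
        by (intro exists_book) (auto simp: W_def cX_def card_gt_0_iff)
      then obtain S where S: "S \<subseteq> U" "card S = b"
          "card {x\<in>X. \<forall>u\<in>S. B u x} \<ge> \<mu> ^ b * card X / 2" by blast
      define T where "T = {x\<in>X. \<forall>u\<in>S. B u x}"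
      have finS: "finite S" using S(1) U(2) finite_subset by blast
      have SX: "S \<subseteq> X" using S(1) U(1) WX by blast
      obtain s0 where s0: "s0 \<in> S" using S(2) b0 by fastforce
      have "s0 \<notin> T" using s0 sw.red_irrefl by (auto simp: T_def)
      then have TX: "T \<subset> X" using s0 SX by (auto simp: T_def)
      have finT: "finite T" using fin by (simp add: T_def)
      have bl: "b \<le> l'"
      proof (rule ccontr)
        assume "\<not> ?thesis"
        have "has_clique B X b" unfolding has_clique_def
          using S U SX finS by (intro exI[of _ S]) blast
        then show False using has_clique_le less.prems(6) \<open>\<not> b \<le> l'\<close> by (metis nle_le)
      qed
      have noB: "\<not> has_clique B T (l' - b)"
      proof
        assume "has_clique B T (l' - b)"
        then have "has_clique B X (card S + (l' - b))"
          unfolding T_def using S(1) U(4) by (intro sw.clique_join SX finS) blast+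
        then show False using less.prems(6) S(2) bl by simp
      qed
      define cT where "cT = real (card T)"
      have cT: "cT \<ge> \<mu> ^ b * cX / 2" using S(3) by (simp add: cT_def T_def cX_def)
      have "\<mu> ^ b * cX / 2 > 0" using \<mu> c by simp
      then have cT0: "cT > 0" using cT by linarith
      have eT: "excess R p T Y \<ge> (1 - 1 / K) * \<theta> * (cT * cY)"
      proof -
        have "(\<Sum>v\<in>T. (1 - 1 / K) * (e / cX)) \<le> excess R p T Y"
          unfolding excess_sum[of R p T Y] using TX by (intro sum_mono reg) auto
        then show ?thesis unfolding ecX by (simp add: cT_def algebra_simps)
      qed
      have pos: "(1 - 1 / K) * \<theta> > 0" using K2 \<theta> by simp
      then have "0 < (1 - 1 / K) * \<theta> * (cT * cY)" using cT0 c by simp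
      then have eT0: "excess R p T Y > 0" using eT by linarith
      have "pot R p K T Y \<le> A * k' + C * real (l' - b) + \<eta> * (real k' + real (l' - b)) + ln Xm + Z0"
        using TX less.prems(5) has_clique_mono[of R "T \<union> Y" k' "X \<union> Y"] noB eT0
        by (intro IH) auto
      \<comment> \<open>The factor 1/2 from the book costs \<open>ln 2 < 1\<close>, and the factor
        \<open>1 - 1 / K\<close> in the density costs at most 2 after the \<open>K\<close>-th power.
        Together this is below \<open>3 \<le> \<eta> * b\<close>, the slack that \<open>b\<close>
        blue steps release.\<close>
      moreover have "pot R p K T Y \<ge> ln cX + b * ln \<mu> - ln 2 + ln cY + (K * ln \<theta> - 2)"
      proof -
        have "ln cX + b * ln \<mu> - ln 2 = ln (\<mu> ^ b * cX / 2)"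
          using \<mu> c by (simp add: ln_div ln_mult ln_realpow)
        also have "\<dots> \<le> ln cT" using cT \<mu> c by (intro ln_mono) auto
        finally have 1: "ln cX + b * ln \<mu> - ln 2 \<le> ln cT" .
        have "1 / K \<le> 1 / 2" using K1 by (simp add: field_simps)
        then have "- (1 / K) - 2 * (1 / K)^2 \<le> ln (1 - 1 / K)"
          using K1 by (intro ln_one_minus_pos_lower_bound) auto
        moreover have "2 * (1 / K)^2 \<le> 1 / K" using K1 by (simp add: field_simps power2_eq_square)
        ultimately have "ln (1 - 1 / K) \<ge> - 2 / K" by simp
        then have "K * ln (1 - 1 / K) \<ge> K * (- 2 / K)" by (intro mult_left_mono) auto
        then have "K * ln (1 - 1 / K) \<ge> - 2" using K1 by simp
        then have "K * ln \<theta> - 2 \<le> K * (ln (1 - 1 / K) + ln \<theta>)" by (simp add: algebra_simps)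
        also have "ln (1 - 1 / K) + ln \<theta> = ln ((1 - 1 / K) * \<theta>)"
          using K2 \<theta> by (intro ln_mult_pos[symmetric]) auto
        also have "\<dots> \<le> ln (excess R p T Y / (cT * cY))"
          using pos eT cT0 c by (intro ln_mono) (auto simp: pos_le_divide_eq)
        finally have 2: "K * ln \<theta> - 2 \<le> K * ln (excess R p T Y / (cT * cY))"
          by (simp add: mult_left_mono)
        show ?thesis unfolding pot_def using 1 2 by (simp add: cT_def cY_def)
      qed
      moreover have "C * real (l' - b) = C * l' - C * b" "\<eta> * (real k' + real (l' - b)) = \<eta> * (real k' + real l') - \<eta> * b"
        using bl by (simp_all add: of_nat_diff algebra_simps)
      moreover have "b * (- ln \<mu>) \<le> b * C" using C by (intro mult_left_mono) auto
      ultimately show False using big b ln_2_less_1 unfolding RHS_def by (simp add: algebra_simps)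
    qed
    \<comment> \<open>The averaging errors are given the order \<open>1 / K^2\<close> that the
      second-order term \<open>u^2\<close> of \<open>step_inequality\<close> has anyway.\<close>
    define \<kappa> where "\<kappa> = 1 / real K ^ 2"
    have \<kappa>: "\<kappa> > 0" "\<kappa> \<le> 1 / 4"
    proof -
      have "2^2 \<le> real K ^ 2" using K1 by (intro power_mono) auto
      then show "\<kappa> > 0" "\<kappa> \<le> 1 / 4" using K1 by (auto simp: \<kappa>_def field_simps)
    qed
    have "real (card W) < \<kappa> * \<theta> * p * card X"
    proof -
      have "real (card W) < real ((k + m) choose k)" using cardW by simp
      also have "\<dots> = \<kappa> * \<tau> * p * (real ((k + m) choose k) * real K^2 / (\<tau> * p))"
        using \<tau> p K1 by (simp add: \<kappa>_def)
      also have "\<dots> \<le> \<kappa> * \<tau> * p * Xm" using Xm \<kappa> \<tau> p by (intro mult_left_mono) auto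
      also have "\<dots> \<le> \<kappa> * \<theta> * p * cX"
        using \<kappa> \<tau> p \<theta>\<tau> cXm Xm1 by (intro mult_mono) auto
      finally show ?thesis by (simp add: cX_def)
    qed
    then have "\<exists>v\<in>X - W. excess R p X {y\<in>Y. R v y} \<ge> (1 - \<kappa>) * \<theta> * card X * card {y\<in>Y. R v y}"
      using fin p less.prems(4) reg0 \<kappa> WX
      by (intro exists_good_vertex) (auto simp: \<theta>_def e_def cX_def cY_def)
    then obtain v where v: "v \<in> X" "v \<notin> W"
      and ev: "excess R p X {y\<in>Y. R v y} \<ge> (1 - \<kappa>) * \<theta> * card X * card {y\<in>Y. R v y}" by blast
    define Y' where "Y' = {y\<in>Y. R v y}"
    define cY' where "cY' = real (card Y')"
    define XR where "XR = {x\<in>X. R v x}"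
    define XB where "XB = {x\<in>X. B v x}"
    have Y': "Y' \<subseteq> Y" "finite Y'" using fin by (auto simp: Y'_def)
    have cY': "cY' \<ge> p * cY"
      using reg0[OF v(1)] fin by (simp add: excess_vertex cY'_def Y'_def cY_def)
    have "p * cY > 0" using p c by simp
    then have cY'0: "cY' > 0" using cY' by linarith
    have Xsplit: "X = {v} \<union> (XR \<union> XB)" "v \<notin> XR" "v \<notin> XB" "XR \<inter> XB = {}" "finite XR" "finite XB"
      using v fin red_irrefl blue_iff by (auto simp: XR_def XB_def)
    define r where "r = card XR / cX"
    define x where "x = card XB / cX"
    have rx: "r \<ge> 0" "x \<ge> 0" "r + x \<le> 1" "x \<le> \<mu>"
    proof -
      have "real (card X) = 1 + (card XR + card XB)"
        using card_neighbours[OF fin(1) v(1)] by (simp add: XR_def XB_def)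
      then have "(real (card XR) + real (card XB)) / cX \<le> 1" using c by (simp add: cX_def)
      then show "r + x \<le> 1" by (simp add: r_def x_def add_divide_distrib)
      show "x \<le> \<mu>" using v c by (simp add: W_def x_def XB_def field_simps not_le)
    qed (use c in \<open>auto simp: r_def x_def\<close>)
    have split: "excess R p X Y' = excess R p {v} Y' + (excess R p XR Y' + excess R p XB Y')"
      using Xsplit excess_Un[of "{v}" "XR \<union> XB" R p Y'] excess_Un[of XR XB R p Y'] by simp
    define FR where "FR = excess R p XR Y' / (\<theta> * cX * cY')"
    define FB where "FB = excess R p XB Y' / (\<theta> * cX * cY')"
    define t where "t = \<theta> * cX * cY'"
    have t: "t > 0" using \<theta> c cY'0 by (simp add: t_def)
    have sum: "FR + FB \<ge> 1 - 2 * \<kappa>"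
    proof -
      have "excess R p {v} Y' \<le> cY'"
        using excess_le[of "{v}" Y' p R] Y' p by (simp add: cY'_def)
      also have "\<dots> \<le> \<kappa> * t"
      proof -
        have "1 = \<kappa> * \<tau> * (real K ^ 2 / \<tau>)" using \<tau> K1 by (simp add: \<kappa>_def)
        also have "\<dots> \<le> \<kappa> * \<theta> * cX"
          using \<kappa> \<tau> \<theta>\<tau> Kt cXm by (intro mult_mono) auto
        finally have "1 * cY' \<le> (\<kappa> * \<theta> * cX) * cY'" using cY'0 by (intro mult_right_mono) auto
        then show ?thesis by (simp add: t_def algebra_simps)
      qed
      finally have "excess R p XR Y' + excess R p XB Y' \<ge> (1 - 2 * \<kappa>) * t"
        using ev split by (simp add: t_def Y'_def cY'_def cX_def algebra_simps)
      then have "(excess R p XR Y' + excess R p XB Y') / t \<ge> 1 - 2 * \<kappa>"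
        using t by (simp add: pos_le_divide_eq)
      then show ?thesis by (simp add: FR_def FB_def t_def add_divide_distrib)
    qed
    \<comment> \<open>A bound on the relative excess of either colour class, found by solving the
      induction hypothesis for it. Passing from \<open>Y\<close> to \<open>Y'\<close> costs at most
      \<open>q\<close>, because \<open>Y'\<close> has at least \<open>p * cY\<close>
      elements.\<close>
    have part: "F \<le> z * exp ((q - G - \<eta> - ln z) / K)"
      if X': "X' \<subset> X" and z: "z = card X' / cX" and F: "F = excess R p X' Y' / (\<theta> * cX * cY')"
        and bd: "excess R p X' Y' > 0 \<Longrightarrow> pot R p K X' Y' \<le> RHS - G - \<eta>" for X' z F G
    proof (cases "excess R p X' Y' > 0")
      case False
      then have "excess R p X' Y' \<le> 0" by simp
      then have "F \<le> 0" using t by (simp add: F t_def divide_nonpos_pos)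
      moreover have "z \<ge> 0" using c by (simp add: z)
      ultimately show ?thesis by (meson exp_ge_zero mult_nonneg_nonneg order_trans)
    next
      case True
      have finX': "finite X'" using X' fin finite_subset by blast
      have cX': "real (card X') > 0" using excess_pos_nonempty[OF True finX' Y'(2)] by simp
      have z0: "z > 0" using cX' c by (simp add: z)
      have F0: "F > 0" using True t by (simp add: F t_def)
      have "excess R p X' Y' / (card X' * cY') = F / z * \<theta>"
        using c cX' cY'0 \<theta> by (simp add: F z)
      moreover have "ln (F / z * \<theta>) = ln F - ln z + ln \<theta>"
        using F0 z0 \<theta> by (simp add: ln_mult ln_div)
      ultimately have "ln (card X') + ln cY' + K * (ln F - ln z + ln \<theta>) \<le> RHS - G - \<eta>"
        using bd[OF True] by (simp add: pot_def cY'_def)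
      moreover have "ln (card X') = ln z + ln cX"
        using z0 c by (simp add: z ln_mult_pos[symmetric])
      moreover have "ln cY' \<ge> ln cY - q"
      proof -
        have "ln cY - q = ln (p * cY)" using p c by (simp add: q ln_mult)
        also have "\<dots> \<le> ln cY'" using cY' p c by (intro ln_mono) auto
        finally show ?thesis .
      qed
      ultimately have "K * (ln F - ln z) \<le> q - G - \<eta> - ln z"
        using big by (simp add: algebra_simps)
      then have "ln F - ln z \<le> (q - G - \<eta> - ln z) / K"
        using K1 by (simp add: pos_le_divide_eq mult.commute)
      then have "exp (ln F) \<le> exp (ln z + (q - G - \<eta> - ln z) / K)" by simp
      then show ?thesis using F0 z0 by (simp add: exp_add)
    qed
    have k'0: "k' > 0" using less.prems(5) by (intro gr0I) auto
    have l'0: "l' > 0" using less.prems(6) by (intro gr0I) auto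
    have red: "FR \<le> r * exp ((q - A - \<eta> - ln r) / K)"
    proof (rule part[OF _ r_def FR_def])
      show "XR \<subset> X" using Xsplit v by auto
      assume ex: "excess R p XR Y' > 0"
      have "\<not> has_clique R (XR \<union> Y') (k' - 1)"
      proof
        assume "has_clique R (XR \<union> Y') (k' - 1)"
        then have "has_clique R {u\<in>X \<union> Y. R v u} (k' - 1)"
          by (rule has_clique_mono) (auto simp: XR_def Y'_def)
        then show False using clique_extend[of v "X \<union> Y" "k' - 1"] v less.prems(5) k'0 by simp
      qed
      moreover have "\<not> has_clique B XR l'"
        using less.prems(6) has_clique_mono[of B XR l' X] Xsplit(1) by blast
      ultimately have "pot R p K XR Y'
          \<le> A * real (k' - 1) + C * l' + \<eta> * (real (k' - 1) + real l') + ln Xm + Z0"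
        using ex Y' \<open>XR \<subset> X\<close> by (intro IH) auto
      also have "\<dots> = RHS - A - \<eta>" using k'0 by (simp add: RHS_def of_nat_diff algebra_simps)
      finally show "pot R p K XR Y' \<le> RHS - A - \<eta>" .
    qed
    have blue: "FB \<le> x * exp ((q - C - \<eta> - ln x) / K)"
    proof (rule part[OF _ x_def FB_def])
      show "XB \<subset> X" using Xsplit v by auto
      assume ex: "excess R p XB Y' > 0"
      have "\<not> has_clique B XB (l' - 1)"
        using sw.clique_extend[OF v(1), of "l' - 1"] less.prems(6) l'0 by (auto simp: XB_def)
      moreover have "\<not> has_clique R (XB \<union> Y') k'"
        using less.prems(5) has_clique_mono[of R "XB \<union> Y'" k' "X \<union> Y"] Xsplit(1) Y' by blast
      ultimately have "pot R p K XB Y'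
          \<le> A * k' + C * real (l' - 1) + \<eta> * (real k' + real (l' - 1)) + ln Xm + Z0"
        using ex Y' \<open>XB \<subset> X\<close> by (intro IH) auto
      also have "\<dots> = RHS - C - \<eta>" using l'0 by (simp add: RHS_def of_nat_diff algebra_simps)
      finally show "pot R p K XB Y' \<le> RHS - C - \<eta>" .
    qed
    define u where "u = q / ((1 - \<mu>) * K)"
    have q0: "q \<ge> 0" using p by (simp add: q)
    have u1: "u = q / (1 - \<mu>) / K" by (simp add: u_def)
    have ule: "u \<le> 1" unfolding u1 using KD(2) K1 by (subst pos_divide_le_eq) auto
    have "(r * exp ((q - A - ln r) / K) + x * exp ((q - C - ln x) / K)) \<le> 1 + u^2"
      using step_inequality[OF \<mu> q0 _ rx u_def ule A(1) C] K1 by simp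
    also have "\<dots> \<le> exp (u^2)" by simp
    finally have "(r * exp ((q - A - ln r) / K) + x * exp ((q - C - ln x) / K)) * exp (- \<eta> / K)
        \<le> exp (u^2) * exp (- \<eta> / K)" by (intro mult_right_mono) auto
    also have "\<dots> = exp (u^2 - \<eta> / K)" by (simp add: mult_exp_exp)
    also have "(r * exp ((q - A - ln r) / K) + x * exp ((q - C - ln x) / K)) * exp (- \<eta> / K)
        = r * exp ((q - A - \<eta> - ln r) / K) + x * exp ((q - C - \<eta> - ln x) / K)"
      by (simp add: algebra_simps mult_exp_exp add_divide_distrib[symmetric] diff_divide_distrib)
    finally have "1 - 2 * \<kappa> \<le> exp (u^2 - \<eta> / K)" using red blue sum by linarith
    \<comment> \<open>After multiplication by \<open>K^2\<close> this is the first assumption in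
      \<open>KD\<close>: the slack \<open>\<eta> / K\<close> beats both kinds of second-order
      error.\<close>
    also have "\<dots> < exp (- 4 * \<kappa>)"
    proof -
      have "real K^2 * ((w / K)^2 + 4 * (1 / real K^2)) = w^2 + 4" for w
        using K1 by (simp add: power_divide algebra_simps)
      then have "real K^2 * (u^2 + 4 * \<kappa>) = (q / (1 - \<mu>))^2 + 4" unfolding u1 \<kappa>_def .
      also have "\<dots> < \<eta> * K" by (rule KD)
      also have "\<dots> = real K^2 * (\<eta> / K)" using K1 by (simp add: power2_eq_square)
      finally have "u^2 + 4 * \<kappa> < \<eta> / K" by (rule mult_left_less_imp_less) simp
      then show ?thesis by simp
    qed
    also have "\<dots> \<le> 1 - 2 * \<kappa>"
    proof -
      have "- (2 * \<kappa>) - 2 * (2 * \<kappa>)^2 \<le> ln (1 - 2 * \<kappa>)"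
        using \<kappa> by (intro ln_one_minus_pos_lower_bound) auto
      moreover have "2 * (2 * \<kappa>)^2 \<le> 2 * \<kappa>" 
        using \<kappa> by (simp add: power2_eq_square mult_le_cancel_left1)
      ultimately have "- 4 * \<kappa> \<le> ln (1 - 2 * \<kappa>)" by simp
      then have "exp (- 4 * \<kappa>) \<le> exp (ln (1 - 2 * \<kappa>))" by simp
      then show ?thesis using \<kappa> by simp
    qed
    finally show False by simp
  qed
qed

end

section \<open>Bootstrapping linear bounds for the Ramsey exponent\<close>

text \<open>R(k, l) \<le> x for a real \<open>x\<close>, so that exponentials enter without
  rounding. \<open>V\<close> is an arbitrary finite set, so the bound applies directly to
  neighbourhoods.\<close>

definition ramsey_bound :: "nat \<Rightarrow> nat \<Rightarrow> real \<Rightarrow> bool" where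
  "ramsey_bound k l x \<longleftrightarrow> (\<forall>R B :: nat \<Rightarrow> nat \<Rightarrow> bool. \<forall>V. two_colouring R B \<longrightarrow> finite V \<longrightarrow> x \<le> card V
     \<longrightarrow> has_clique R V k \<or> has_clique B V l)"

lemma ramsey_boundD:
  fixes R B :: "nat \<Rightarrow> nat \<Rightarrow> bool"
  assumes "ramsey_bound k l x" "two_colouring R B" "finite V"
    and "\<not> has_clique R V k" "\<not> has_clique B V l"
  shows "real (card V) < x"
proof (rule ccontr)
  assume "\<not> real (card V) < x"
  then have "x \<le> real (card V)" by simp
  then show False using assms unfolding ramsey_bound_def by blast
qed

lemma ramsey_bound_mono: "ramsey_bound k l x \<Longrightarrow> x \<le> y \<Longrightarrow> ramsey_bound k l y"
  unfolding ramsey_bound_def by (meson order_trans)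

lemma ramsey_bound_swap: "ramsey_bound k l x \<Longrightarrow> ramsey_bound l k x"
  unfolding ramsey_bound_def using two_colouring.swap_colours by blast

lemma ramsey_bound_binomial: "ramsey_bound k l ((k + l) choose k)"
  unfolding ramsey_bound_def of_nat_le_iff by (intro allI impI ramsey_binomial)

text \<open>One summand of the binomial expansion of
  \<open>(exp (- a) + exp (- b)) ^ (k + l) \<le> 1\<close>. With equality in the hypothesis, these
  lines are the tangents of the entropy exponent in the Erdos--Szekeres bound.\<close>

lemma ramsey_bound_exp:
  assumes "exp (- a) + exp (- b) \<le> (1 :: real)"
  shows "ramsey_bound k l (exp (a * k + b * l))"
proof (rule ramsey_bound_mono[OF ramsey_bound_binomial])
  have "real ((k + l) choose k) * exp (- a) ^ k * exp (- b) ^ (k + l - k)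
      \<le> (\<Sum>i\<le>k + l. real ((k + l) choose i) * exp (- a) ^ i * exp (- b) ^ (k + l - i))"
    by (rule member_le_sum) auto
  also have "\<dots> = (exp (- a) + exp (- b)) ^ (k + l)" by (rule binomial_ring[symmetric])
  also have "\<dots> \<le> 1" using assms by (intro power_le_one) (auto intro: add_nonneg_nonneg)
  finally have "real ((k + l) choose k) * exp (- (a * k + b * l)) \<le> 1"
    by (simp add: exp_of_nat_mult[symmetric] mult.assoc mult_exp_exp algebra_simps)
  then have "real ((k + l) choose k) * exp (- (a * k + b * l)) * exp (a * k + b * l)
      \<le> 1 * exp (a * k + b * l)" by (intro mult_right_mono) auto
  then show "real ((k + l) choose k) \<le> exp (a * k + b * l)"
    by (simp add: mult.assoc mult_exp_exp)
qed

text \<open>The data of one run of the recursion: \<open>1 - exp (- b)\<close> is the red density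
  forced by the bound for R(k, l - 1), \<open>\<mu>\<close> the threshold for blue degrees,
  \<open>A\<close> and \<open>\<gamma>\<close> the prices of a red and a blue step, and (a', b') the
  line that bounds the final \<open>Y\<close>.\<close>

definition valid_row :: "real \<Rightarrow> real \<Rightarrow> real \<Rightarrow> real \<Rightarrow> real \<Rightarrow> real \<Rightarrow> real \<Rightarrow> bool" where
  "valid_row b p \<mu> A \<gamma> a' b' \<longleftrightarrow>
     0 \<le> b \<and> 0 < p \<and> p < 1 \<and> p \<le> 1 - exp (- b) \<and> 0 < \<mu> \<and> \<mu> < 1 \<and>
     A \<ge> - ln p / (1 - \<mu>) - ln (1 - \<mu>) \<and> \<gamma> \<ge> - ln \<mu> \<and> 0 \<le> a' \<and> a' \<le> A \<and> 0 \<le> b'"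

text \<open>Two estimates for the potential of (V, V) collide: from below \<open>2 * ln n\<close> up
  to a constant, as the degrees force a constant density excess, and from above the total price. It
  is essential that \<open>n0\<close> is chosen before \<open>C\<close>: \<open>ln C\<close> enters
  \<open>2 * ln n\<close> twice, and it enters the upper bound once through the bound on
  \<open>Y\<close> and once through \<open>\<tau>\<close>.\<close>

lemma bootstrap_step:
  fixes \<epsilon> a b p \<mu> A \<gamma> a' b' :: real
  assumes \<epsilon>: "\<epsilon> > 0" and a: "0 \<le> a" and row: "valid_row b p \<mu> A \<gamma> a' b'"
  shows "\<exists>n0. \<forall>k l C. n0 \<le> k + l \<longrightarrow> 1 \<le> l \<longrightarrow> 1 \<le> C
    \<longrightarrow> ramsey_bound k (l - 1) (C * exp (\<epsilon> * (real k + real l - 1) + a * k + b * (real l - 1)))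
    \<longrightarrow> (\<forall>k'<k. ramsey_bound k' l (C * exp (\<epsilon> * (real k' + real l) + a' * k' + b' * l)))
    \<longrightarrow> a * k + b * l \<le> a' * k + b' * l
    \<longrightarrow> A * k + (\<gamma> + b') * l \<le> 2 * (a * k + b * l)
    \<longrightarrow> ramsey_bound k l (C * exp (\<epsilon> * (real k + real l) + a * k + b * l))"
proof -
  have b: "0 \<le> b" and p: "0 < p" "p < 1" "p \<le> 1 - exp (- b)" and \<mu>: "0 < \<mu>" "\<mu> < 1"
    and A: "A \<ge> - ln p / (1 - \<mu>) - ln (1 - \<mu>)" and \<gamma>: "\<gamma> \<ge> - ln \<mu>"
    and a': "0 \<le> a'" "a' \<le> A" and b': "0 \<le> b'"
    using row unfolding valid_row_def by auto
  define \<eta> where "\<eta> = \<epsilon> / 4"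
  define q where "q = - ln p"
  define D where "D = q / (1 - \<mu>)"
  \<comment> \<open>The summands provide, in turn, \<open>K \<ge> 2\<close>,
    \<open>u \<le> 1\<close>, the condition on \<open>\<eta> * K\<close> in
    \<open>pot_bound\<close>, and the term \<open>x / 8\<close> in the estimate of \<open>t\<close>
    below.\<close>
  obtain K :: nat where K: "real K \<ge> 2 + D + (D^2 + 4) / \<eta> + 16 * (\<epsilon> + a + b) / \<epsilon>"
    using real_arch_simple by blast
  obtain s :: nat where s: "real s \<ge> 3 / \<eta>" using real_arch_simple by blast
  obtain m :: nat where m: "real m \<ge> 2 * real s ^ 2 / \<mu> ^ s" using real_arch_simple by blast
  \<comment> \<open>Going from \<open>l\<close> to \<open>l - 1\<close> gains the factor
    \<open>exp (- \<epsilon>)\<close> besides \<open>exp (- b)\<close>, and this gap is the initial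
    excess. Half of it is given up because \<open>v\<close> is not its own neighbour.\<close>
  define \<theta>0 where "\<theta>0 = exp (- b) * (1 - exp (- \<epsilon>)) / 2"
  define H where "H = K * ln \<theta>0"
  define c where "c = 2 * ln K - ln p + 2 * ln 2 - H"
  have \<eta>: "\<eta> > 0" using \<epsilon> by (simp add: \<eta>_def)
  have q: "q \<ge> 0" using p by (simp add: q_def)
  have D: "D \<ge> 0" using q \<mu> by (simp add: D_def)
  have K2: "real K \<ge> 2" "K \<ge> 2" "D \<le> K" "(D^2 + 4) / \<eta> < K" "16 * (\<epsilon> + a + b) / \<epsilon> \<le> K"
  proof -
    have "(D^2 + 4) / \<eta> \<ge> 0" "16 * (\<epsilon> + a + b) / \<epsilon> \<ge> 0" using \<eta> \<epsilon> a b by auto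
    then show *: "real K \<ge> 2" "D \<le> K" "(D^2 + 4) / \<eta> < K" "16 * (\<epsilon> + a + b) / \<epsilon> \<le> K"
      using K D by linarith+
    show "K \<ge> 2" using *(1) by linarith
  qed
  have \<theta>0: "\<theta>0 > 0" using \<epsilon> by (simp add: \<theta>0_def)
  have "\<forall>\<^sub>F x in sequentially. real m * ln (real x + real m) + c < 5 / 8 * \<epsilon> * real x"
    using \<epsilon> by real_asymp
  moreover have "\<forall>\<^sub>F x in sequentially. exp (\<epsilon> * real x) * \<theta>0 \<ge> 1"
    using \<epsilon> \<theta>0 by real_asymp
  ultimately have "\<forall>\<^sub>F x in sequentially. real m * ln (real x + real m) + c < 5 / 8 * \<epsilon> * real x
      \<and> exp (\<epsilon> * real x) * \<theta>0 \<ge> 1" by (rule eventually_conj)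
  then obtain n0 where n0: "\<And>x. x \<ge> n0 \<Longrightarrow> real m * ln (real x + real m) + c < 5 / 8 * \<epsilon> * real x"
      "\<And>x. x \<ge> n0 \<Longrightarrow> exp (\<epsilon> * real x) * \<theta>0 \<ge> 1"
    unfolding eventually_sequentially by blast
  show ?thesis
  proof (intro exI[of _ n0] allI impI)
    fix k l :: nat and C :: real
    assume kl: "n0 \<le> k + l" "1 \<le> l" and C: "1 \<le> C"
      and IH1: "ramsey_bound k (l - 1) (C * exp (\<epsilon> * (real k + real l - 1) + a * k + b * (real l - 1)))"
      and IH2: "\<forall>k'<k. ramsey_bound k' l (C * exp (\<epsilon> * (real k' + real l) + a' * k' + b' * l))"
      and min: "a * k + b * l \<le> a' * k + b' * l"
      and ineq: "A * k + (\<gamma> + b') * l \<le> 2 * (a * k + b * l)"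
    define N where "N = C * exp (\<epsilon> * (real k + real l) + a * k + b * l)"
    have N1: "N \<ge> exp (\<epsilon> * (real k + real l))"
    proof -
      have "1 * exp (\<epsilon> * (real k + real l)) \<le> N"
        unfolding N_def using C a b by (intro mult_mono) auto
      then show ?thesis by simp
    qed
    have "exp (\<epsilon> * (real k + real l)) \<ge> 1" using \<epsilon> by simp
    then have N1': "N \<ge> 1" using N1 by linarith
    have lnN: "ln N = ln C + \<epsilon> * (real k + real l) + a * k + b * l"
      using C by (simp add: N_def ln_mult)
    show "ramsey_bound k l (C * exp (\<epsilon> * (real k + real l) + a * k + b * l))"
      unfolding ramsey_bound_def N_def[symmetric]
    proof (intro allI impI, rule ccontr)
      fix R B :: "nat \<Rightarrow> nat \<Rightarrow> bool" and V0 :: "nat set"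
      assume RB: "two_colouring R B" and V0: "finite V0" "N \<le> card V0"
        and no: "\<not> (has_clique R V0 k \<or> has_clique B V0 l)"
      interpret two_colouring R B by (rule RB)
      interpret sw: two_colouring B R by (rule swap_colours)
      \<comment> \<open>The vertex set is cut down to about \<open>N\<close> vertices, because
        \<open>ln n\<close> is needed from above as well: for \<open>\<tau>\<close>, and for
        \<open>Y\<close> when \<open>k' = k\<close>.\<close>
      have "nat \<lceil>N\<rceil> \<le> card V0" using V0(2) by (simp add: nat_le_iff ceiling_le_iff)
      then obtain V where V: "V \<subseteq> V0" "card V = nat \<lceil>N\<rceil>" "finite V"
        by (rule obtain_subset_with_card_n)
      define n where "n = real (card V)"
      have n: "N \<le> n" "n \<le> 2 * N" using V(2) N1' by (auto simp: n_def) linarith+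
      have noR: "\<not> has_clique R W k" and noB: "\<not> has_clique B W l" if "W \<subseteq> V" for W
        using no that V(1) has_clique_mono[of _ W _ V0] by blast+
      have deg: "excess R p {v} V \<ge> n * \<theta>0" if v: "v \<in> V" for v
      proof -
        let ?W = "{u\<in>V. B v u}"
        have "\<not> has_clique B ?W (l - 1)"
          using sw.clique_extend[OF v, of "l - 1"] noB[of V] kl by auto
        moreover have "\<not> has_clique R ?W k" by (rule noR) auto
        ultimately have "real (card ?W) < C * exp (\<epsilon> * (real k + real l - 1) + a * k + b * (real l - 1))"
          using V(3) by (intro ramsey_boundD[OF IH1 RB]) auto
        also have "\<dots> = N * exp (- \<epsilon> - b)" by (simp add: N_def mult_exp_exp algebra_simps)
        also have "\<dots> \<le> n * exp (- \<epsilon> - b)" using n by (intro mult_right_mono) auto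
        finally have "real (card ?W) \<le> n * exp (- \<epsilon> - b)" by simp
        moreover have "n = 1 + (real (card {u\<in>V. R v u}) + real (card ?W))"
          using card_neighbours[OF V(3) v] by (simp add: n_def)
        moreover have "1 \<le> n * \<theta>0"
        proof -
          have "1 \<le> exp (\<epsilon> * real (k + l)) * \<theta>0" using n0(2) kl(1) by blast
          also have "\<dots> \<le> n * \<theta>0" using N1 n \<theta>0 by (intro mult_right_mono) auto
          finally show ?thesis .
        qed
        moreover have "n * p \<le> n * (1 - exp (- b))" using p by (intro mult_left_mono) (auto simp: n_def)
        moreover have "n * (1 - exp (- b)) + 2 * (n * \<theta>0) = n - n * exp (- \<epsilon> - b)"
          by (simp add: \<theta>0_def algebra_simps mult_exp_exp diff_divide_distrib)
        moreover have "excess R p {v} V = real (card {u\<in>V. R v u}) - n * p"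
          using V(3) by (simp add: excess_vertex n_def mult.commute)
        ultimately show ?thesis by linarith
      qed
      have n1: "n \<ge> 1" using n N1' by linarith
      have "(\<Sum>v\<in>V. n * \<theta>0) \<le> excess R p V V"
        unfolding excess_sum[of R p V V] by (intro sum_mono deg)
      then have ex: "n * n * \<theta>0 \<le> excess R p V V" by (simp add: n_def)
      have "n * n * \<theta>0 > 0" using n1 \<theta>0 by simp
      then have ex0: "excess R p V V > 0" using ex by linarith
      define \<tau> where "\<tau> = exp (- 2 * ln n / K)"
      define Xm where "Xm = real ((k + m) choose k) * real K^2 / (\<tau> * p)"
      have Ybound: "ln (card Y) \<le> (a' + \<epsilon>) * k' + (ln 2 + ln C + (\<epsilon> + b') * l)"
        if Y: "Y \<subseteq> V" "Y \<noteq> {}" "k' \<le> k" "\<not> has_clique R Y k'" "\<not> has_clique B Y l" for Y k'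
      proof -
        have finY: "finite Y" using Y V(3) finite_subset by blast
        have Y0: "real (card Y) > 0" using Y finY by (simp add: card_gt_0_iff)
        have "real (card Y) \<le> 2 * C * exp (\<epsilon> * (real k' + real l) + a' * k' + b' * l)"
        proof (cases "k' = k")
          \<comment> \<open>No induction hypothesis exists for \<open>k' = k\<close>. The size of
            \<open>V\<close> itself serves, because (a, b) does not exceed (a', b') at (k,
            l).\<close>
          case True
          have "real (card Y) \<le> n" unfolding n_def using V Y by (intro of_nat_mono card_mono) auto
          also have "\<dots> \<le> 2 * N" by (rule n)
          also have "\<dots> \<le> 2 * (C * exp (\<epsilon> * (real k' + real l) + a' * k' + b' * l))"
            unfolding N_def using True min C by (intro mult_left_mono) auto
          finally show ?thesis by simp
        next
          case False
          then have "ramsey_bound k' l (C * exp (\<epsilon> * (real k' + real l) + a' * k' + b' * l))"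
            using IH2 Y(3) by simp
          then have "real (card Y) \<le> C * exp (\<epsilon> * (real k' + real l) + a' * k' + b' * l)"
            using ramsey_boundD[OF _ RB finY Y(4,5)] less_imp_le by blast
          also have "\<dots> \<le> 2 * C * exp (\<epsilon> * (real k' + real l) + a' * k' + b' * l)"
            using C by (intro mult_right_mono) auto
          finally show ?thesis .
        qed
        then have "ln (card Y) \<le> ln (2 * C * exp (\<epsilon> * (real k' + real l) + a' * k' + b' * l))"
          using Y0 by (intro ln_mono)
        also have "\<dots> = ln 2 + ln C + (\<epsilon> * (real k' + real l) + a' * k' + b' * l)"
          using C by (simp add: ln_mult)
        finally show ?thesis by (simp add: algebra_simps)
      qed
      have sK: "3 \<le> \<eta> * real s" using s \<eta> by (simp add: pos_divide_le_eq mult.commute)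
      have mb: "2 * real s ^ 2 \<le> real m * \<mu> ^ s" using m \<mu> by (simp add: pos_divide_le_eq)
      have KD: "D^2 + 4 < \<eta> * K" using K2(4) \<eta> by (simp add: pos_divide_less_eq mult.commute)
      have lnn: "ln n \<ge> 0" using n1 by simp
      have lnC: "ln C \<ge> 0" using C by simp
      define x where "x = \<epsilon> * (real k + real l)"
      define t where "t = 2 / K * ln n"
      define y where "y = a * k + b * l"
      define M where "M = m * ln (real (k + l) + real m)"
      have "pot R p K V V \<le> (A + \<epsilon>) * k + \<gamma> * l + \<eta> * (real k + real l) + ln Xm
          + (ln 2 + ln C + (\<epsilon> + b') * l)"
      proof (rule pot_bound[where N = n and \<tau> = \<tau> and q = q and \<mu> = \<mu> and a = "a' + \<epsilon>" and b = s
            and m = m and k = k and l = l and V = V])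
        show "2 \<le> K" by (rule K2)
        show "(q / (1 - \<mu>))^2 + 4 < \<eta> * K" "q / (1 - \<mu>) \<le> K"
          using KD K2(3) by (simp_all add: D_def)
        show "q / (1 - \<mu>) - ln (1 - \<mu>) \<le> A + \<epsilon>" using A \<epsilon> by (simp add: q_def)
        show "\<tau> \<le> 1" unfolding \<tau>_def using lnn K2 by (simp add: divide_nonpos_pos)
        show "K * ln \<tau> \<le> - 2 * ln n" using K2(1) by (simp add: \<tau>_def)
        show "0 \<le> ln 2 + ln C + (\<epsilon> + b') * l" using lnC \<epsilon> b' by simp
        show "real ((k + m) choose k) * (real K)\<^sup>2 / (\<tau> * p) \<le> Xm" by (simp add: Xm_def)
        show "\<not> has_clique R (V \<union> V) k" using noR by simp
      qed (use p \<mu> \<eta> sK mb a' \<epsilon> \<gamma> n1 V(3) Ybound ex0 noB in \<open>auto simp: q_def \<tau>_def n_def\<close>)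
      then have "pot R p K V V \<le> A * k + \<gamma> * l + b' * l + x + x / 4 + ln Xm + ln 2 + ln C"
        by (simp add: x_def \<eta>_def algebra_simps)
      moreover have "pot R p K V V \<ge> 2 * ln n + H"
      proof -
        have "\<theta>0 \<le> excess R p V V / (card V * card V)"
          using ex n1 by (simp add: n_def pos_le_divide_eq algebra_simps)
        then have "ln \<theta>0 \<le> ln (excess R p V V / (card V * card V))" using \<theta>0 by (intro ln_mono)
        then have "K * ln \<theta>0 \<le> K * ln (excess R p V V / (card V * card V))"
          by (intro mult_left_mono) auto
        then show ?thesis by (simp add: pot_def n_def H_def)
      qed
      moreover have "ln Xm \<le> M + 2 * ln K - ln p + t"
      proof -
        have "ln Xm = ln (real ((k + m) choose k)) + 2 * ln K - ln p + 2 / K * ln n"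
          using p K2(1) by (simp add: Xm_def ln_mult ln_div ln_realpow \<tau>_def)
        moreover have "ln (real ((k + m) choose k)) \<le> M"
        proof -
          have "(k + m) choose k = (k + m) choose m" using binomial_symmetric[of k "k + m"] by simp
          also have "\<dots> \<le> (k + m) ^ m"
            by (cases "m \<le> k + m") (use binomial_le_pow in auto)
          finally have "ln (real ((k + m) choose k)) \<le> ln (real ((k + m) ^ m))"
            by (intro ln_mono of_nat_mono) (auto simp: zero_less_binomial)
          also have "\<dots> = m * ln (real (k + m))" by (simp add: ln_realpow)
          also have "\<dots> \<le> m * ln (real (k + l) + real m)"
            using kl by (cases "k + m = 0") (auto intro!: mult_left_mono ln_mono)
          finally show ?thesis unfolding M_def .
        qed
        ultimately show ?thesis by (simp add: t_def)
      qed
      moreover have "t \<le> ln 2 + ln C + x / 8"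
      proof -
        have "ln n \<le> ln (2 * N)" using n n1 by (intro ln_mono) auto
        also have "\<dots> = ln 2 + ln C + (\<epsilon> * (real k + real l) + a * k + b * l)"
          using N1' lnN by (simp add: ln_mult)
        also have "\<dots> \<le> ln 2 + ln C + (\<epsilon> + a + b) * (real k + real l)"
          using a b by (simp add: algebra_simps)
        finally have "2 / K * ln n \<le> 2 / K * (ln 2 + ln C + (\<epsilon> + a + b) * (real k + real l))"
          by (intro mult_left_mono) auto
        also have "\<dots> = 2 / K * (ln 2 + ln C) + (2 / K * (\<epsilon> + a + b)) * (real k + real l)"
          by (simp add: algebra_simps add_divide_distrib)
        also have "\<dots> \<le> 1 * (ln 2 + ln C) + \<epsilon> / 8 * (real k + real l)"
        proof (intro add_mono mult_right_mono)
          have "16 * (\<epsilon> + a + b) \<le> K * \<epsilon>" using K2(5) \<epsilon> by (simp add: pos_divide_le_eq)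
          then show "2 / K * (\<epsilon> + a + b) \<le> \<epsilon> / 8" using K2(1) by (simp add: field_simps)
        qed (use K2(1) lnC in \<open>auto simp: field_simps\<close>)
        finally show ?thesis by (simp add: x_def t_def)
      qed
      moreover have "2 * ln n \<ge> 2 * (ln C + x + y)"
      proof -
        have "ln N \<le> ln n" using n(1) N1' by (intro ln_mono) auto
        then show ?thesis by (simp add: lnN x_def y_def)
      qed
      \<comment> \<open>Of \<open>2 * x\<close> in the lower bound, \<open>x + x / 4\<close> is
        spent by the bound on the potential and \<open>x / 8\<close> by \<open>t\<close>;
        \<open>5 / 8 * x\<close> remains for the sublinear terms.\<close>
      moreover have "M + c < 5 / 8 * x"
        using n0(1)[OF kl(1)] by (simp add: M_def x_def algebra_simps)
      moreover have "A * k + \<gamma> * l + b' * l \<le> 2 * y"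
        using ineq by (simp add: y_def algebra_simps)
      ultimately show False unfolding c_def by argo
    qed
  qed
qed

text \<open>One induction on \<open>k + l\<close> for all lines together. At (k, l) only the minimal
  line needs an argument, by Erdos--Szekeres or by a row of \<open>T\<close>. Symmetry of
  \<open>L\<close> reduces everything to \<open>l \<le> k\<close>.\<close>

lemma ramsey_bound_lines:
  fixes L :: "(real \<times> real) set" and \<epsilon> :: real
    and T :: "(real \<times> real \<times> real \<times> real \<times> real \<times> real \<times> real \<times> real) set"
  assumes \<epsilon>: "\<epsilon> > 0" and nonneg: "\<And>a b. (a, b) \<in> L \<Longrightarrow> 0 \<le> a \<and> 0 \<le> b"
    and swap: "\<And>a b. (a, b) \<in> L \<Longrightarrow> (b, a) \<in> L"
    and T: "finite T" "\<And>a b p \<mu> A \<gamma> a' b'. (a, b, p, \<mu>, A, \<gamma>, a', b') \<in> T \<Longrightarrow>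
        0 \<le> a \<and> valid_row b p \<mu> A \<gamma> a' b' \<and> (a', b') \<in> L"
    and cover: "\<And>k l. Suc 0 \<le> l \<Longrightarrow> l \<le> k \<Longrightarrow> \<exists>a b. (a, b) \<in> L \<and>
        (\<forall>a2 b2. (a2, b2) \<in> L \<longrightarrow> a * k + b * l \<le> a2 * k + b2 * l) \<and>
        (exp (- a) + exp (- b) \<le> 1 \<or> (\<exists>p \<mu> A \<gamma> a' b'. (a, b, p, \<mu>, A, \<gamma>, a', b') \<in> T \<and>
          A * k + (\<gamma> + b') * l \<le> 2 * (a * k + b * l)))"
  shows "\<exists>C\<ge>1. \<forall>k l a b. (a, b) \<in> L \<longrightarrow>
    ramsey_bound k l (C * exp (\<epsilon> * (real k + real l) + a * k + b * l))"
proof -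
  define Q where "Q = (\<lambda>(a, b, p :: real, \<mu> :: real, A :: real, \<gamma>, a', b') n0. \<forall>k l C. n0 \<le> k + l \<longrightarrow> 1 \<le> l \<longrightarrow> 1 \<le> C
    \<longrightarrow> ramsey_bound k (l - 1) (C * exp (\<epsilon> * (real k + real l - 1) + a * k + b * (real l - 1)))
    \<longrightarrow> (\<forall>k'<k. ramsey_bound k' l (C * exp (\<epsilon> * (real k' + real l) + a' * k' + b' * l)))
    \<longrightarrow> a * k + b * l \<le> a' * k + b' * l
    \<longrightarrow> A * k + (\<gamma> + b') * l \<le> 2 * (a * k + b * l)
    \<longrightarrow> ramsey_bound k l (C * exp (\<epsilon> * (real k + real l) + a * k + b * l)))"
  have "\<exists>n0 :: nat. Q r n0" if "r \<in> T" for r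
  proof -
    obtain a b p \<mu> A \<gamma> a' b' where r: "r = (a, b, p, \<mu>, A, \<gamma>, a', b')" by (cases r) auto
    show ?thesis unfolding r Q_def prod.case
      using T(2) that \<epsilon> unfolding r by (intro bootstrap_step[where p = p and \<mu> = \<mu>]) auto
  qed
  then obtain g :: "_ \<Rightarrow> nat" where g: "\<And>r. r \<in> T \<Longrightarrow> Q r (g r)" by metis
  define n0 where "n0 = Max (insert 0 (g ` T))"
  have n0: "g r \<le> n0" if "r \<in> T" for r unfolding n0_def using T(1) that by (intro Max_ge) auto
  \<comment> \<open>This makes all bounds trivial for \<open>k + l < n0\<close>, and it is a
    legitimate choice because no threshold \<open>g r\<close> depends on \<open>C\<close>.\<close>
  define C where "C = (2 :: real) ^ n0"
  have C: "1 \<le> C" by (simp add: C_def)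
  have "\<forall>a b. (a, b) \<in> L \<longrightarrow> ramsey_bound k l (C * exp (\<epsilon> * (real k + real l) + a * k + b * l))" for k l
  proof (induction "k + l" arbitrary: k l rule: less_induct)
    case less
    have main: "ramsey_bound k l (C * exp (\<epsilon> * (real k + real l) + a * k + b * l))"
      if kl: "l \<le> k" and L: "(a, b) \<in> L"
        and IH: "\<And>k' l' a b. k' + l' < k + l \<Longrightarrow> (a, b) \<in> L \<Longrightarrow>
          ramsey_bound k' l' (C * exp (\<epsilon> * (real k' + real l') + a * k' + b * l'))" for k l a b
    proof (cases "l = 0")
      case True
      then show ?thesis by (simp add: ramsey_bound_def)
    next
      case False
      then have l: "Suc 0 \<le> l" and l1: "1 \<le> l" by simp_all
      obtain a0 b0 where ab0: "(a0, b0) \<in> L"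
          "\<forall>a2 b2. (a2, b2) \<in> L \<longrightarrow> a0 * k + b0 * l \<le> a2 * k + b2 * l"
          "exp (- a0) + exp (- b0) \<le> 1 \<or> (\<exists>p \<mu> A \<gamma> a' b'. (a0, b0, p, \<mu>, A, \<gamma>, a', b') \<in> T \<and>
          A * k + (\<gamma> + b') * l \<le> 2 * (a0 * k + b0 * l))"
        using cover[OF l kl] by blast
      have "ramsey_bound k l (C * exp (\<epsilon> * (real k + real l) + a0 * k + b0 * l))"
        using ab0(3)
      proof
        assume "exp (- a0) + exp (- b0) \<le> 1"
        then have "ramsey_bound k l (exp (a0 * k + b0 * l))" by (rule ramsey_bound_exp)
        moreover have "1 * exp (a0 * k + b0 * l) \<le> C * exp (\<epsilon> * (real k + real l) + a0 * k + b0 * l)"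
          using C \<epsilon> by (intro mult_mono) auto
        ultimately show ?thesis using ramsey_bound_mono by simp
      next
        assume "\<exists>p \<mu> A \<gamma> a' b'. (a0, b0, p, \<mu>, A, \<gamma>, a', b') \<in> T \<and>
          A * k + (\<gamma> + b') * l \<le> 2 * (a0 * k + b0 * l)"
        then obtain p \<mu> A \<gamma> a' b' where r: "(a0, b0, p, \<mu>, A, \<gamma>, a', b') \<in> T"
          and ineq: "A * k + (\<gamma> + b') * l \<le> 2 * (a0 * k + b0 * l)" by blast
        have ab': "(a', b') \<in> L" using T(2)[OF r] by blast
        show ?thesis
        proof (cases "n0 \<le> k + l")
          case True
          then have "g (a0, b0, p, \<mu>, A, \<gamma>, a', b') \<le> k + l" using n0[OF r] by linarith
          moreover have "ramsey_bound k (l - 1) (C * exp (\<epsilon> * (real k + real l - 1) + a0 * k + b0 * (real l - 1)))"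
            using IH[of k "l - 1" a0 b0] ab0(1) l by (simp add: of_nat_diff add_diff_eq)
          moreover have "\<forall>k'<k. ramsey_bound k' l (C * exp (\<epsilon> * (real k' + real l) + a' * k' + b' * l))"
            using IH ab' by simp
          moreover have "a0 * k + b0 * l \<le> a' * k + b' * l" using ab0(2) ab' by blast
          ultimately show ?thesis using g[OF r] l1 C ineq unfolding Q_def prod.case by blast
        next
          case False
          have "real ((k + l) choose k) \<le> real (2 ^ n0)"
          proof (intro of_nat_mono)
            have "(k + l) choose k \<le> 2 ^ (k + l)" by (rule binomial_le_pow2)
            also have "\<dots> \<le> 2 ^ n0" using False by (intro power_increasing) auto
            finally show "(k + l) choose k \<le> 2 ^ n0" .
          qed
          also have "\<dots> \<le> C * exp (\<epsilon> * (real k + real l) + a0 * k + b0 * l)"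
            using C \<epsilon> nonneg[OF ab0(1)] by (simp add: C_def)
          finally show ?thesis by (rule ramsey_bound_mono[OF ramsey_bound_binomial])
        qed
      qed
      moreover have "a0 * k + b0 * l \<le> a * k + b * l" using ab0(2) L by blast
      ultimately show ?thesis using C by (elim ramsey_bound_mono) auto
    qed
    have IH: "ramsey_bound k' l' (C * exp (\<epsilon> * (real k' + real l') + a * k' + b * l'))"
      if "k' + l' < k + l" "(a, b) \<in> L" for k' l' a b
      using less[of k' l'] that by blast
    then have IH': "ramsey_bound k' l' (C * exp (\<epsilon> * (real k' + real l') + a * k' + b * l'))"
      if "k' + l' < l + k" "(a, b) \<in> L" for k' l' a b
      using that by (simp add: add.commute)
    show ?case
    proof (intro allI impI)
      fix a b assume L: "(a, b) \<in> L"
      show "ramsey_bound k l (C * exp (\<epsilon> * (real k + real l) + a * k + b * l))"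
      proof (cases "l \<le> k")
        case True
        then show ?thesis using L IH by (rule main)
      next
        case False
        then have "k \<le> l" by simp
        then have "ramsey_bound l k (C * exp (\<epsilon> * (real l + real k) + b * l + a * k))"
          using swap[OF L] IH' by (rule main)
        then have "ramsey_bound k l (C * exp (\<epsilon> * (real l + real k) + b * l + a * k))"
          by (rule ramsey_bound_swap)
        then show ?thesis by (simp add: algebra_simps)
      qed
    qed
  qed
  then show ?thesis using C by blast
qed

section \<open>A certified family of lines\<close>

lemma exp_ge_taylor:
  fixes x :: real
  assumes "0 \<le> x"
  shows "(\<Sum>i\<le>n. x ^ i / fact i) \<le> exp x"
proof -
  have "(\<Sum>i\<in>{..n}. x ^ i /\<^sub>R fact i) \<le> (\<Sum>i. x ^ i /\<^sub>R fact i)"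
    using assms by (intro sum_le_suminf summable_exp_generic) auto
  then show ?thesis by (simp add: exp_def divide_inverse mult.commute)
qed

text \<open>The lines and rows below were found by numerical optimisation of the recursion. Every number is a
  decimal fraction with denominator \<open>10\<^sup>5\<close>; \<open>exp_check r y\<close> certifies \<open>exp y \<ge> 1 / r\<close> by the Taylor
  polynomial of degree 10.\<close>

definition exp_check :: "int \<Rightarrow> int \<Rightarrow> bool" where
  "exp_check r y \<longleftrightarrow> 0 < r \<and> 0 \<le> y \<and>
     3628800 * 10 ^ 55 \<le> r * (((((((((((y + 10 * 10 ^ 5) * y + 90 * 10 ^ 10) * y + 720 * 10 ^ 15) * y
       + 5040 * 10 ^ 20) * y + 30240 * 10 ^ 25) * y + 151200 * 10 ^ 30) * y + 604800 * 10 ^ 35) * y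
       + 1814400 * 10 ^ 40) * y + 3628800 * 10 ^ 45) * y + 3628800 * 10 ^ 50))"

lemma exp_check:
  assumes "exp_check r y"
  shows "exp (- (y / 10 ^ 5)) \<le> r / 10 ^ 5" "- ln (r / 10 ^ 5) \<le> y / 10 ^ 5" "0 < r" "0 \<le> y"
proof -
  show r: "0 < r" and y: "0 \<le> y" using assms unfolding exp_check_def by auto
  define x where "x = real_of_int y / 10 ^ 5"
  have yx: "real_of_int y = x * 10 ^ 5" by (simp add: x_def)
  have "real_of_int (3628800 * 10 ^ 55)
     \<le> real_of_int (r * (((((((((((y + 10 * 10 ^ 5) * y + 90 * 10 ^ 10) * y + 720 * 10 ^ 15) * y
       + 5040 * 10 ^ 20) * y + 30240 * 10 ^ 25) * y + 151200 * 10 ^ 30) * y + 604800 * 10 ^ 35) * y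
       + 1814400 * 10 ^ 40) * y + 3628800 * 10 ^ 45) * y + 3628800 * 10 ^ 50)))"
    using assms unfolding exp_check_def of_int_le_iff by blast
  \<comment> \<open>\<open>3628800\<close> is the factorial of 10; together with
    \<open>10 ^ 50\<close> it clears the denominators of the Taylor polynomial at
    \<open>y / 10 ^ 5\<close>.\<close>
  also have "\<dots> = r * (3628800 * 10 ^ 50 * (\<Sum>i\<le>10. x ^ i / fact i))"
    unfolding of_int_mult of_int_add of_int_power of_int_numeral yx
    by (simp add: eval_nat_numeral fact_reduce) (simp add: algebra_simps)
  also have "\<dots> \<le> r * (3628800 * 10 ^ 50 * exp x)"
    using r y by (intro mult_left_mono exp_ge_taylor) (auto simp: x_def)
  finally have "1 \<le> r / 10 ^ 5 * exp x" by simp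
  then have "1 * exp (- x) \<le> r / 10 ^ 5 * exp x * exp (- x)" by (intro mult_right_mono) auto
  then show *: "exp (- (y / 10 ^ 5)) \<le> r / 10 ^ 5" by (simp add: x_def mult.assoc mult_exp_exp)
  have "ln (exp (- (y / 10 ^ 5))) \<le> ln (r / 10 ^ 5)" using * by (intro ln_mono) auto
  then show "- ln (r / 10 ^ 5) \<le> y / 10 ^ 5" by simp
qed

type_synonym row = "int \<times> int \<times> int \<times> int \<times> int \<times> int \<times> int \<times> int \<times> int \<times> int \<times> int \<times> int"

text \<open>The third entry \<open>r\<close> splits 1 so that \<open>exp (- a)\<close> and
  \<open>exp (- b)\<close> stay below the two parts. These lines therefore follow from
  Erdos--Szekeres; with their small \<open>a\<close> they serve very unbalanced \<open>k\<close> and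
  \<open>l\<close>.\<close>

definition free_lines :: "(int \<times> int \<times> int) list" where
  "free_lines =
  [(3116, 348546, 96933), (4133, 320746, 95952), (5473, 293300, 94675),
   (7233, 266266, 93023), (9532, 239793, 90909)]"

definition improved_lines :: "row list" where
  "improved_lines =
  [(16305, 172064, 82103, 9989, 19721, 10525, 230372, 32442, 32442, 113240, 0, 0),
   (16368, 171486, 82000, 9904, 19847, 10431, 231227, 32460, 32442, 113240, 21656, 27802),
   (16427, 170982, 81909, 10579, 19958, 11183, 224633, 33503, 33485, 110915, 38249, 17287),
   (16520, 170238, 81774, 12796, 20123, 13693, 205605, 36769, 36769, 104203, 40097, 0),
   (16644, 169304, 81603, 13422, 20332, 14414, 200829, 37899, 37891, 102102, 37186, 0),
   (16852, 167821, 81328, 13165, 20669, 14118, 202762, 37921, 37891, 102102, 20275, 0),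
   (17058, 166434, 81067, 13689, 20991, 14723, 198859, 39044, 39026, 100066, 23923, 0),
   (17301, 164886, 80772, 14991, 21355, 16243, 189774, 41364, 41352, 96153, 37251, 7979),
   (17588, 163154, 80436, 14675, 21772, 15872, 191904, 41389, 41352, 96153, 30370, 7517),
   (17921, 161245, 80059, 15119, 22242, 16393, 188923, 42597, 42564, 94240, 26621, 5552),
   (18301, 159175, 79642, 16338, 22764, 17840, 181169, 45050, 45025, 90595, 22232, 0),
   (18658, 157328, 79262, 15973, 23243, 17405, 183429, 45067, 45025, 90595, 27450, 4268),
   (19138, 154969, 78767, 17132, 23869, 18794, 176424, 47598, 47592, 87098, 19421, 0),
   (19563, 152982, 78341, 19342, 24411, 21497, 164291, 51766, 51766, 81980, 36063, 4948),
   (20106, 150564, 77811, 17891, 25090, 19714, 172089, 50271, 50249, 83767, 18525, 0),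
   (20664, 148197, 77280, 20063, 25775, 22395, 160631, 54640, 54593, 78850, 23857, 0),
   (21231, 145904, 76753, 20391, 26459, 22806, 159009, 56043, 56017, 77367, 28620, 4360),
   (21838, 143566, 76203, 19864, 27178, 22146, 161628, 56061, 56017, 77367, 24344, 4774),
   (22339, 141727, 75761, 19418, 27760, 21591, 163898, 56041, 56017, 77367, 22681, 0),
   (22790, 140147, 75375, 19052, 28271, 21138, 165801, 56063, 56017, 77367, 23244, 0),
   (23181, 138840, 75051, 18750, 28702, 20765, 167399, 56091, 56017, 77367, 24883, 0),
   (24333, 135160, 74116, 29482, 29955, 34932, 122141, 77411, 77367, 56017, 24953, 0),
   (25859, 130501, 72882, 28263, 31634, 33218, 126363, 77367, 77367, 56017, 18290, 1753),
   (27149, 126741, 71843, 27329, 33070, 31924, 129724, 77431, 77367, 56017, 17933, 0),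
   (28210, 123785, 70998, 27206, 34253, 31755, 130175, 78850, 78850, 54593, 21141, 0),
   (29259, 120992, 70176, 27999, 35418, 32851, 127302, 82042, 81980, 51766, 24746, 2343),
   (30298, 118346, 69377, 27222, 36563, 31777, 130116, 82017, 81980, 51766, 20617, 0),
   (31355, 115772, 68578, 28105, 37721, 32998, 126924, 85465, 85381, 48934, 21528, 0),
   (32442, 113240, 67773, 28913, 38902, 34128, 124089, 88853, 88824, 46298, 22051, 0),
   (33485, 110915, 67015, 29025, 40027, 34286, 123703, 90682, 90595, 45025, 22735, 0),
   (34590, 108558, 66228, 29882, 41208, 35501, 120793, 94271, 94240, 42564, 22707, 0),
   (35670, 106352, 65475, 30005, 42352, 35676, 120382, 96184, 96153, 41352, 23004, 0),
   (36769, 104203, 64725, 30993, 43504, 37098, 117142, 100141, 100066, 39026, 24207, 0),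
   (37891, 102102, 63976, 31139, 44668, 37310, 116672, 102177, 102102, 37891, 23525, 0),
   (39026, 100066, 63235, 32178, 45833, 38830, 113390, 106409, 106352, 35670, 24985, 0),
   (40174, 98093, 62502, 32343, 46999, 39073, 112879, 108558, 108558, 34590, 24574, 0),
   (41352, 96153, 61768, 32643, 48180, 39518, 111955, 111048, 110915, 33485, 24062, 0),
   (42564, 94240, 61029, 32815, 49384, 39774, 111430, 113279, 113240, 32442, 23227, 0),
   (43768, 92418, 60313, 34126, 50564, 41744, 107513, 118503, 118346, 30298, 25721, 0),
   (45025, 90595, 59583, 34416, 51781, 42185, 106666, 121139, 120992, 29259, 24733, 0),
   (46298, 88824, 58861, 34748, 53001, 42693, 105706, 123919, 123785, 28210, 24606, 0),
   (47592, 87098, 58144, 35140, 54226, 43295, 104585, 126900, 126741, 27149, 24511, 0),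
   (48934, 85381, 57420, 35771, 55479, 44273, 102805, 130650, 130501, 25859, 24428, 0),
   (50249, 83767, 56727, 37899, 56693, 47642, 97026, 138934, 138840, 23181, 29229, 0),
   (51766, 81980, 55947, 37582, 58078, 47133, 97866, 140180, 140147, 22790, 24159, 0),
   (53157, 80408, 55249, 37498, 59333, 46999, 98090, 141929, 141727, 22339, 25604, 0),
   (54593, 78850, 54546, 38135, 60614, 48023, 96405, 146001, 145904, 21231, 27574, 1953),
   (56017, 77367, 53867, 38914, 61867, 49290, 94383, 150569, 150564, 20106, 27062, 0)]"

text \<open>In a row \<open>(a, b, p, \<mu>, \<alpha>, \<beta>, \<gamma>, A, a', b', s, t)\<close> the numbers \<open>\<alpha>\<close>, \<open>\<beta>\<close>, \<open>\<gamma>\<close> bound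
  \<open>- ln p\<close>, \<open>- ln (1 - \<mu>)\<close>, \<open>- ln \<mu>\<close>, while \<open>s\<close>, \<open>t\<close> (scaled by \<open>1000\<close>) are Farkas multipliers that
  derive the inequality for the row on the cone of all \<open>(k, l)\<close> where the line is below its two neighbours.\<close>

definition row_check :: "int \<times> int \<Rightarrow> row \<Rightarrow> int \<times> int \<Rightarrow> bool" where
  "row_check = (\<lambda>(a1, b1) (a, b, p, \<mu>, \<alpha>, \<beta>, \<gamma>, A, a', b', s, t) (a2, b2).
     0 \<le> a \<and> p < 10 ^ 5 \<and> \<mu> < 10 ^ 5 \<and> exp_check (10 ^ 5 - p) b \<and> exp_check p \<alpha> \<and> exp_check (10 ^ 5 - \<mu>) \<beta> \<and>
     exp_check \<mu> \<gamma> \<and> \<alpha> * 10 ^ 5 \<le> (A - \<beta>) * (10 ^ 5 - \<mu>) \<and> 0 \<le> a' \<and> a' \<le> A \<and> 0 \<le> b' \<and> 0 \<le> s \<and> 0 \<le> t \<and>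
     s * (a1 - a) + t * (a2 - a) \<le> 1000 * (2 * a - A) \<and>
     s * (b1 - b) + t * (b2 - b) \<le> 1000 * (2 * b - \<gamma> - b'))"

fun line_of :: "row \<Rightarrow> int \<times> int" where
  "line_of (a, b, _) = (a, b)"

fun target_of :: "row \<Rightarrow> int \<times> int" where
  "target_of (a, b, p, \<mu>, \<alpha>, \<beta>, \<gamma>, A, a', b', s, t) = (a', b')"

text \<open>The rows are ordered by slope, and \<open>P\<close> is the line before the current one.
  The last row borders on its own mirror image, where the family crosses the diagonal.\<close>

fun rows_check :: "int \<times> int \<Rightarrow> row list \<Rightarrow> bool" where
  "rows_check _ [] \<longleftrightarrow> True"
| "rows_check P [r] \<longleftrightarrow> row_check P r (prod.swap (line_of r))"
| "rows_check P (r # r' # rs) \<longleftrightarrow> row_check P r (line_of r') \<and> rows_check (line_of r) (r' # rs)"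

definition lower_lines :: "(int \<times> int) list" where
  "lower_lines = map (\<lambda>(a, b, r). (a, b)) free_lines @ map line_of improved_lines"

definition all_lines :: "(int \<times> int) list" where
  "all_lines = lower_lines @ map prod.swap lower_lines"

lemma rows_check:
  assumes "rows_check P rs" "P \<in> set Ls" "\<forall>r\<in>set rs. line_of r \<in> set Ls \<and> prod.swap (line_of r) \<in> set Ls"
    and "r \<in> set rs"
  shows "\<exists>Q\<in>set Ls. \<exists>Q'\<in>set Ls. row_check Q r Q'"
  using assms by (induction P rs rule: rows_check.induct) auto

lemma free_lines_check:
  "\<forall>(a, b, r)\<in>set free_lines. 0 \<le> a \<and> a \<le> b \<and> exp_check r a \<and> exp_check (10 ^ 5 - r) b"
  by code_simp

lemma improved_lines_check: "rows_check (9532, 239793) improved_lines"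
  by code_simp

lemma improved_lines_targets:
  "\<forall>r\<in>set improved_lines. target_of r \<in> set all_lines \<and> fst (line_of r) \<le> snd (line_of r)"
  by code_simp

lemma row_check_valid:
  assumes "row_check P (a, b, p, \<mu>, \<alpha>, \<beta>, \<gamma>, A, a', b', s, t) Q"
  shows "valid_row (b / 10 ^ 5) (p / 10 ^ 5) (\<mu> / 10 ^ 5) (A / 10 ^ 5) (\<gamma> / 10 ^ 5) (a' / 10 ^ 5) (b' / 10 ^ 5)"
proof -
  have chk: "exp_check (10 ^ 5 - p) b" "exp_check p \<alpha>" "exp_check (10 ^ 5 - \<mu>) \<beta>" "exp_check \<mu> \<gamma>"
    and *: "p < 10 ^ 5" "\<mu> < 10 ^ 5" "\<alpha> * 10 ^ 5 \<le> (A - \<beta>) * (10 ^ 5 - \<mu>)" "0 \<le> a'" "a' \<le> A" "0 \<le> b'"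
    using assms unfolding row_check_def by (auto split: prod.splits)
  have "- ln (real_of_int p / 10 ^ 5) / (1 - \<mu> / 10 ^ 5) \<le> (\<alpha> / 10 ^ 5) / (1 - \<mu> / 10 ^ 5)"
    using exp_check(2)[OF chk(2)] *(2) by (intro divide_right_mono) auto
  also have "\<dots> = \<alpha> / (10 ^ 5 - \<mu>)"
    using *(2) by (simp add: field_simps)
  also have "\<dots> \<le> (A - \<beta>) / 10 ^ 5"
  proof -
    have "real_of_int (\<alpha> * 10 ^ 5) \<le> real_of_int ((A - \<beta>) * (10 ^ 5 - \<mu>))"
      using *(3) unfolding of_int_le_iff .
    then show ?thesis using *(2) by (simp add: divide_le_eq pos_le_divide_eq)
  qed
  finally have 1: "- ln (real_of_int p / 10 ^ 5) / (1 - \<mu> / 10 ^ 5) \<le> (A - \<beta>) / 10 ^ 5" .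
  have 2: "- ln (1 - real_of_int \<mu> / 10 ^ 5) \<le> \<beta> / 10 ^ 5"
    using exp_check(2)[OF chk(3)] by (simp add: diff_divide_distrib)
  have 3: "real_of_int p / 10 ^ 5 \<le> 1 - exp (- (b / 10 ^ 5))"
    using exp_check(1)[OF chk(1)] by (simp add: diff_divide_distrib)
  have 4: "- ln (real_of_int p / 10 ^ 5) / (1 - \<mu> / 10 ^ 5) - ln (1 - \<mu> / 10 ^ 5) \<le> A / 10 ^ 5"
    using 1 2 unfolding diff_divide_distrib of_int_diff by linarith
  have "0 \<le> real_of_int b / 10 ^ 5" "0 < real_of_int p / 10 ^ 5" "real_of_int p / 10 ^ 5 < 1"
      "0 < real_of_int \<mu> / 10 ^ 5" "real_of_int \<mu> / 10 ^ 5 < 1"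
      "0 \<le> real_of_int a' / 10 ^ 5" "real_of_int a' / 10 ^ 5 \<le> A / 10 ^ 5" "0 \<le> real_of_int b' / 10 ^ 5"
    using * exp_check(3)[OF chk(2)] exp_check(4)[OF chk(1)] exp_check(3)[OF chk(4)] by auto
  then show ?thesis
    unfolding valid_row_def using 3 4 exp_check(2)[OF chk(4)] by blast
qed

lemma row_check_ineq:
  fixes k l :: nat
  assumes chk: "row_check (a1, b1) (a, b, p, \<mu>, \<alpha>, \<beta>, \<gamma>, A, a', b', s, t) (a2, b2)"
    and min: "a * k + b * l \<le> a1 * k + b1 * l" "a * k + b * l \<le> a2 * k + b2 * l"
  shows "A * k + (\<gamma> + b') * l \<le> 2 * (a * k + b * l)"
proof -
  have st: "0 \<le> s" "0 \<le> t" and *: "s * (a1 - a) + t * (a2 - a) \<le> 1000 * (2 * a - A)"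
     "s * (b1 - b) + t * (b2 - b) \<le> 1000 * (2 * b - \<gamma> - b')"
    using chk unfolding row_check_def by auto
  have "0 \<le> s * ((a1 * k + b1 * l) - (a * k + b * l)) + t * ((a2 * k + b2 * l) - (a * k + b * l))"
    using st min by (intro add_nonneg_nonneg mult_nonneg_nonneg) auto
  also have "\<dots> = (s * (a1 - a) + t * (a2 - a)) * k + (s * (b1 - b) + t * (b2 - b)) * l"
    by (simp add: algebra_simps)
  also have "\<dots> \<le> (1000 * (2 * a - A)) * k + (1000 * (2 * b - \<gamma> - b')) * l"
    using * by (intro add_mono mult_right_mono) auto
  finally have "0 \<le> 1000 * ((2 * a - A) * int k + (2 * b - \<gamma> - b') * int l)" by (simp add: algebra_simps)
  then have "0 \<le> (2 * a - A) * int k + (2 * b - \<gamma> - b') * int l" by simp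
  then show ?thesis by (simp add: algebra_simps)
qed

definition scale :: "int \<times> int \<Rightarrow> real \<times> real" where
  "scale = (\<lambda>(a, b). (a / 10 ^ 5, b / 10 ^ 5))"

definition scale_row :: "row \<Rightarrow> real \<times> real \<times> real \<times> real \<times> real \<times> real \<times> real \<times> real" where
  "scale_row = (\<lambda>(a, b, p, \<mu>, \<alpha>, \<beta>, \<gamma>, A, a', b', s, t).
     (a / 10 ^ 5, b / 10 ^ 5, p / 10 ^ 5, \<mu> / 10 ^ 5, A / 10 ^ 5, \<gamma> / 10 ^ 5, a' / 10 ^ 5, b' / 10 ^ 5))"

lemma improved_line_row:
  assumes "r \<in> set improved_lines"
  shows "\<exists>Q\<in>set all_lines. \<exists>Q'\<in>set all_lines. row_check Q r Q'"
proof (rule rows_check[OF improved_lines_check _ _ assms])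
  show "(9532, 239793) \<in> set all_lines"
    by (simp add: all_lines_def lower_lines_def free_lines_def)
  show "\<forall>r\<in>set improved_lines. line_of r \<in> set all_lines \<and> prod.swap (line_of r) \<in> set all_lines"
    by (simp add: all_lines_def lower_lines_def)
qed

lemma lower_lines_le: "(a, b) \<in> set lower_lines \<Longrightarrow> 0 \<le> a \<and> a \<le> b"
proof -
  assume "(a, b) \<in> set lower_lines"
  then consider r where "(a, b, r) \<in> set free_lines" | r where "r \<in> set improved_lines" "line_of r = (a, b)"
    unfolding lower_lines_def by force
  then show ?thesis
  proof cases
    case 1
    then show ?thesis using free_lines_check by auto
  next
    case 2
    then obtain Q Q' where "row_check Q r Q'" using improved_line_row by blast
    moreover obtain p \<mu> \<alpha> \<beta> \<gamma> A c d s t where "r = (a, b, p, \<mu>, \<alpha>, \<beta>, \<gamma>, A, c, d, s, t)"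
      using 2(2) by (cases r) auto
    ultimately have "0 \<le> a" by (cases Q, cases Q') (auto simp: row_check_def)
    then show ?thesis using 2 improved_lines_targets by force
  qed
qed

text \<open>For \<open>l \<le> k\<close> a mirrored line never beats its original: exchanging the
  coefficients of a line with \<open>a \<le> b\<close> adds
  \<open>(b - a) * (k - l)\<close>.\<close>

lemma cover_lines:
  fixes k l :: nat
  assumes "l \<le> k"
  shows "\<exists>a b. (a, b) \<in> set lower_lines \<and> (\<forall>a2 b2. (a2, b2) \<in> set all_lines \<longrightarrow> a * k + b * l \<le> a2 * k + b2 * l)"
proof -
  let ?f = "\<lambda>(a, b). a * int k + b * int l"
  have "finite (?f ` set lower_lines)" "?f ` set lower_lines \<noteq> {}"
    by (auto simp: lower_lines_def free_lines_def)
  then have "Min (?f ` set lower_lines) \<in> ?f ` set lower_lines" by (rule Min_in)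
  then obtain a b where ab: "(a, b) \<in> set lower_lines" "a * k + b * l = Min (?f ` set lower_lines)" by auto
  have low: "a * k + b * l \<le> a2 * k + b2 * l" if "(a2, b2) \<in> set lower_lines" for a2 b2
    unfolding ab(2) using that by (intro Min_le) (auto intro!: image_eqI[of _ _ "(a2, b2)"])
  have "a * k + b * l \<le> a2 * k + b2 * l" if mem: "(a2, b2) \<in> set all_lines" for a2 b2
  proof -
    consider "(a2, b2) \<in> set lower_lines" | "(b2, a2) \<in> set lower_lines"
      using mem unfolding all_lines_def by force
    then show ?thesis
    proof cases
      case 2
      have "0 \<le> (a2 - b2) * (int k - int l)"
        using lower_lines_le[OF 2] assms by (intro mult_nonneg_nonneg) auto
      then show ?thesis using low[OF 2] by (simp add: algebra_simps)
    qed (rule low)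
  qed
  then show ?thesis using ab(1) by blast
qed

lemma ramsey_bound_table:
  fixes \<epsilon> :: real
  assumes "\<epsilon> > 0"
  shows "\<exists>C\<ge>1. \<forall>k l a b. (a, b) \<in> set lower_lines \<longrightarrow>
    ramsey_bound k l (C * exp (\<epsilon> * (real k + real l) + a / 10 ^ 5 * k + b / 10 ^ 5 * l))"
proof -
  have "\<exists>C\<ge>1. \<forall>k l a b. (a, b) \<in> scale ` set all_lines \<longrightarrow>
    ramsey_bound k l (C * exp (\<epsilon> * (real k + real l) + a * k + b * l))"
  proof (rule ramsey_bound_lines[OF assms, where T = "scale_row ` set improved_lines"])
    fix a b assume "(a, b) \<in> scale ` set all_lines"
    then obtain i j where ij: "a = i / 10 ^ 5" "b = j / 10 ^ 5" "(i, j) \<in> set all_lines"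
      by (auto simp: scale_def)
    then have *: "(i, j) \<in> set lower_lines \<or> (j, i) \<in> set lower_lines" by (auto simp: all_lines_def)
    then have "0 \<le> i \<and> 0 \<le> j" using lower_lines_le by force
    then show "0 \<le> a \<and> 0 \<le> b" using ij by simp
    have "(j, i) \<in> set all_lines" using * by (force simp: all_lines_def)
    then show "(b, a) \<in> scale ` set all_lines"
      using ij by (intro image_eqI[of _ _ "(j, i)"]) (simp_all add: scale_def)
  next
    show "finite (scale_row ` set improved_lines)" by simp
  next
    fix a b p \<mu> A \<gamma> a' b'
    assume "(a, b, p, \<mu>, A, \<gamma>, a', b') \<in> scale_row ` set improved_lines"
    then obtain r where r: "r \<in> set improved_lines" "(a, b, p, \<mu>, A, \<gamma>, a', b') = scale_row r" by blast
    obtain a0 b0 p0 \<mu>0 \<alpha>0 \<beta>0 \<gamma>0 A0 a'0 b'0 s0 t0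
      where r0: "r = (a0, b0, p0, \<mu>0, \<alpha>0, \<beta>0, \<gamma>0, A0, a'0, b'0, s0, t0)" by (cases r) auto
    have eqs: "a = a0 / 10 ^ 5" "b = b0 / 10 ^ 5" "p = p0 / 10 ^ 5" "\<mu> = \<mu>0 / 10 ^ 5" "A = A0 / 10 ^ 5"
        "\<gamma> = \<gamma>0 / 10 ^ 5" "a' = a'0 / 10 ^ 5" "b' = b'0 / 10 ^ 5"
      using r(2) unfolding r0 scale_row_def by simp_all
    obtain Q Q' where "row_check Q r Q'" using improved_line_row[OF r(1)] by blast
    then have "valid_row b p \<mu> A \<gamma> a' b'" unfolding r0 eqs by (rule row_check_valid)
    moreover have "line_of r \<in> set lower_lines" using r(1) unfolding lower_lines_def by simp
    then have "0 \<le> a" using lower_lines_le unfolding r0 eqs by simp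
    moreover have "target_of r \<in> set all_lines" using improved_lines_targets r(1) by blast
    then have "(a', b') \<in> scale ` set all_lines"
      unfolding r0 eqs by (intro image_eqI[of _ _ "(a'0, b'0)"]) (simp_all add: scale_def)
    ultimately show "0 \<le> a \<and> valid_row b p \<mu> A \<gamma> a' b' \<and> (a', b') \<in> scale ` set all_lines" by blast
  next
    fix k l :: nat
    assume "l \<le> k"
    then obtain a b where ab: "(a, b) \<in> set lower_lines"
      and min: "\<And>a2 b2. (a2, b2) \<in> set all_lines \<Longrightarrow> a * k + b * l \<le> a2 * k + b2 * l"
      using cover_lines by blast
    define a' where "a' = a / 10 ^ 5"
    define b' where "b' = b / 10 ^ 5"
    have sc: "real_of_int i / 10 ^ 5 * k + real_of_int j / 10 ^ 5 * l = real_of_int (i * k + j * l) / 10 ^ 5" for i j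
      by (simp add: add_divide_distrib)
    have min': "a' * k + b' * l \<le> a2 * k + b2 * l" if mem: "(a2, b2) \<in> scale ` set all_lines" for a2 b2
    proof -
      obtain i j where ij: "a2 = i / 10 ^ 5" "b2 = j / 10 ^ 5" "(i, j) \<in> set all_lines"
        using mem by (auto simp: scale_def)
      have "real_of_int (a * k + b * l) \<le> real_of_int (i * k + j * l)"
        using min[OF ij(3)] unfolding of_int_le_iff .
      then show ?thesis unfolding a'_def b'_def ij sc by (intro divide_right_mono) auto
    qed
    have inL: "(a', b') \<in> scale ` set all_lines"
      using ab by (intro image_eqI[of _ _ "(a, b)"]) (auto simp: scale_def a'_def b'_def all_lines_def)
    consider r where "(a, b, r) \<in> set free_lines" | r where "r \<in> set improved_lines" "line_of r = (a, b)"
      using ab unfolding lower_lines_def by force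
    then have "exp (- a') + exp (- b') \<le> 1 \<or> (\<exists>p \<mu> A \<gamma> a'' b''. (a', b', p, \<mu>, A, \<gamma>, a'', b'')
        \<in> scale_row ` set improved_lines \<and> A * k + (\<gamma> + b'') * l \<le> 2 * (a' * k + b' * l))"
    proof cases
      case 1
      then have chk: "exp_check r a" "exp_check (10 ^ 5 - r) b" using free_lines_check by auto
      show ?thesis
        using exp_check(1)[OF chk(1)] exp_check(1)[OF chk(2)]
        by (simp add: a'_def b'_def diff_divide_distrib)
    next
      case 2
      obtain p \<mu> \<alpha> \<beta> \<gamma> A c d s t where r: "r = (a, b, p, \<mu>, \<alpha>, \<beta>, \<gamma>, A, c, d, s, t)"
        using 2(2) by (cases r) auto
      obtain a1 b1 a2 b2 where Q: "(a1, b1) \<in> set all_lines" "(a2, b2) \<in> set all_lines"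
          "row_check (a1, b1) r (a2, b2)"
        using improved_line_row[OF 2(1)] by fast
      have "A * k + (\<gamma> + d) * l \<le> 2 * (a * k + b * l)"
        using row_check_ineq[OF Q(3)[unfolded r] min[OF Q(1)] min[OF Q(2)]] .
      then have "real_of_int (A * k + (\<gamma> + d) * l) \<le> real_of_int (2 * (a * k + b * l))"
        unfolding of_int_le_iff .
      then have "real_of_int (A * k + (\<gamma> + d) * l) / 10 ^ 5 \<le> real_of_int (2 * (a * k + b * l)) / 10 ^ 5"
        by (intro divide_right_mono) auto
      then have "A / 10 ^ 5 * k + (\<gamma> / 10 ^ 5 + d / 10 ^ 5) * l \<le> 2 * (a' * k + b' * l)"
        by (simp add: a'_def b'_def add_divide_distrib algebra_simps)
      moreover have "(a', b', p / 10 ^ 5, \<mu> / 10 ^ 5, A / 10 ^ 5, \<gamma> / 10 ^ 5, c / 10 ^ 5, d / 10 ^ 5)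
          \<in> scale_row ` set improved_lines"
        using 2(1) by (intro image_eqI[of _ _ r]) (simp_all add: r scale_row_def a'_def b'_def)
      ultimately show ?thesis by blast
    qed
    then show "\<exists>a b. (a, b) \<in> scale ` set all_lines \<and>
        (\<forall>a2 b2. (a2, b2) \<in> scale ` set all_lines \<longrightarrow> a * k + b * l \<le> a2 * k + b2 * l) \<and>
        (exp (- a) + exp (- b) \<le> 1 \<or> (\<exists>p \<mu> A \<gamma> a' b'. (a, b, p, \<mu>, A, \<gamma>, a', b')
          \<in> scale_row ` set improved_lines \<and> A * k + (\<gamma> + b') * l \<le> 2 * (a * k + b * l)))"
      using inL min' by blast
  qed
  then obtain C where C: "C \<ge> 1" "\<And>k l a b. (a, b) \<in> scale ` set all_lines \<Longrightarrow>
    ramsey_bound k l (C * exp (\<epsilon> * (real k + real l) + a * k + b * l))" by blast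
  have "(a / 10 ^ 5, b / 10 ^ 5) \<in> scale ` set all_lines" if "(a, b) \<in> set lower_lines" for a b
    using that by (intro image_eqI[of _ _ "(a, b)"]) (simp_all add: scale_def all_lines_def)
  then show ?thesis using C by blast
qed

section \<open>From Ramsey bounds to the ratio of chromatic number and clique number\<close>

text \<open>The difference of the two sides is a convex quadratic in \<open>x\<close>, so its sign
  at the endpoints carries over to the interval.\<close>

lemma quadratic_between:
  fixes a b c u v x :: real
  assumes "u \<le> x" "x \<le> v" "u < v" "(a + b * u)^2 \<le> c * u" "(a + b * v)^2 \<le> c * v"
  shows "(a + b * x)^2 \<le> c * x"
proof -
  have "0 \<le> b^2 * (v - u) * (x - u) * (v - x)" using assms by simp
  also have "\<dots> = (v - x) * ((a + b * u)^2 - c * u) + (x - u) * ((a + b * v)^2 - c * v)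
      - (v - u) * ((a + b * x)^2 - c * x)"
    by (simp add: power2_eq_square algebra_simps)
  also have "\<dots> \<le> - ((v - u) * ((a + b * x)^2 - c * x))"
  proof -
    have "(v - x) * ((a + b * u)^2 - c * u) \<le> 0" "(x - u) * ((a + b * v)^2 - c * v) \<le> 0"
      using assms by (auto intro!: mult_nonneg_nonpos)
    then show ?thesis by linarith
  qed
  finally have "(v - u) * ((a + b * x)^2 - c * x) \<le> 0" by simp
  then show ?thesis using assms(3) by (simp add: mult_le_0_iff)
qed

text \<open>By homogeneity only \<open>x = l / k\<close> matters, and two lines suffice on
  [1/10, 1]. The tightest place is the diagonal: 0.56017 + 0.77367 = 1.33384 has square 1.77913,
  just below 89/50, while 3.70831 times the square of ln 2 is about 1.7817.\<close>

lemma lower_line_sqrt: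
  fixes k l :: nat
  assumes "1 \<le> l" "l \<le> k" "k \<le> 10 * l"
  shows "\<exists>a b. (a, b) \<in> set lower_lines \<and> a / 10 ^ 5 * k + b / 10 ^ 5 * l \<le> sqrt (89 / 50 * k * l)"
proof -
  define x where "x = real l / real k"
  have k: "real k > 0" using assms by simp
  have x: "1 / 10 \<le> x" "x \<le> 1" using assms k by (auto simp: x_def field_simps)
  have "\<exists>a b. (a, b) \<in> set lower_lines \<and> (a / 10 ^ 5 + b / 10 ^ 5 * x)^2 \<le> 89 / 50 * x"
  proof (cases "x \<le> 53 / 100")
    case True
    have "(22790 / 10 ^ 5 + 140147 / 10 ^ 5 * x)^2 \<le> 89 / 50 * x"
      using x True by (intro quadratic_between[of "1 / 10" x "53 / 100"]) (auto simp: power2_eq_square)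
    moreover have "(22790, 140147) \<in> set lower_lines"
      by (simp add: lower_lines_def improved_lines_def)
    ultimately show ?thesis by (intro exI[of _ 22790] exI[of _ 140147]) simp
  next
    case False
    have "(56017 / 10 ^ 5 + 77367 / 10 ^ 5 * x)^2 \<le> 89 / 50 * x"
      using x False by (intro quadratic_between[of "53 / 100" x 1]) (auto simp: power2_eq_square)
    moreover have "(56017, 77367) \<in> set lower_lines"
      by (simp add: lower_lines_def improved_lines_def)
    ultimately show ?thesis by (intro exI[of _ 56017] exI[of _ 77367]) simp
  qed
  then obtain a b where ab: "(a, b) \<in> set lower_lines" "(a / 10 ^ 5 + b / 10 ^ 5 * x)^2 \<le> 89 / 50 * x"
    by blast
  have "(a / 10 ^ 5 * k + b / 10 ^ 5 * l)^2 = (k * (a / 10 ^ 5 + b / 10 ^ 5 * x))^2"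
    using k by (simp add: x_def algebra_simps)
  also have "\<dots> = real k^2 * (a / 10 ^ 5 + b / 10 ^ 5 * x)^2" by (rule power_mult_distrib)
  also have "\<dots> \<le> real k^2 * (89 / 50 * x)" using ab(2) by (rule mult_left_mono) simp
  also have "\<dots> = 89 / 50 * k * l" using k by (simp add: x_def power2_eq_square)
  finally have "a / 10 ^ 5 * k + b / 10 ^ 5 * l \<le> sqrt (89 / 50 * k * l)" by (rule real_le_rsqrt)
  then show ?thesis using ab(1) by blast
qed

text \<open>With \<open>z = k / l\<close> the left side times \<open>l\<close> dominates the
  Erdos--Szekeres exponent, so from ratio 10 onwards the table is not consulted. The proof uses
  \<open>ln y \<le> y / exp 1\<close> for \<open>y = sqrt (1 + z)\<close>, and
  \<open>1.3 ^ 2 = 1.69 < 1.78\<close>.\<close>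

lemma ln_le_sqrt:
  fixes z :: real
  assumes "10 \<le> z"
  shows "1 + ln (1 + z) \<le> sqrt (89 / 50 * z)"
proof -
  define w where "w = sqrt z"
  define y where "y = sqrt (1 + z)"
  have w: "w^2 = z" "w \<ge> 3" using assms by (auto simp: w_def intro!: real_le_rsqrt)
  have y: "y > 0" "y^2 = 1 + z" using assms by (auto simp: y_def)
  have "y \<le> 105 / 100 * w"
  proof (rule power2_le_imp_le)
    show "y^2 \<le> (105 / 100 * w)^2" using assms w by (simp add: y power_mult_distrib power_divide)
  qed (use w in auto)
  moreover have "ln (1 + z) \<le> 8 / 10 * y"
  proof -
    have e: "exp 1 \<ge> (5 / 2 :: real)" using exp_lower_Taylor_quadratic[of 1] by simp
    have "ln (1 + z) = 2 * ln y" using y by (simp add: y_def ln_sqrt)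
    also have "ln y = 1 + ln (y / exp 1)" using y by (simp add: ln_div)
    also have "\<dots> \<le> y / exp 1" using ln_le_minus_one[of "y / exp 1"] y by simp
    also have "\<dots> \<le> y / (5 / 2)" using e y by (intro divide_left_mono) auto
    finally show ?thesis by simp
  qed
  ultimately have "1 + ln (1 + z) \<le> 13 / 10 * w" using w(2) by simp
  also have "\<dots> \<le> sqrt (89 / 50 * z)" by (rule real_le_rsqrt) (use w assms in \<open>simp add: power_mult_distrib power_divide\<close>)
  finally show ?thesis .
qed

lemma ramsey_bound_unbalanced:
  fixes k l :: nat
  assumes "1 \<le> l" "10 * l \<le> k"
  shows "ramsey_bound k l (exp (sqrt (89 / 50 * k * l)))"
proof -
  \<comment> \<open>The tangent of the entropy exponent at the point (k, l) itself.\<close>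
  define a where "a = ln (1 + real l / k)"
  define b where "b = ln (1 + real k / l)"
  have kl: "real k > 0" "real l > 0" "real k / l \<ge> 10" using assms by (auto simp: field_simps)
  have "exp (- a) = real k / (k + l)" "exp (- b) = real l / (k + l)"
    using kl by (auto simp: a_def b_def exp_minus field_simps add_pos_pos)
  then have "exp (- a) + exp (- b) \<le> 1" using kl by (simp add: add_divide_distrib[symmetric])
  then have "ramsey_bound k l (exp (a * k + b * l))" by (rule ramsey_bound_exp)
  moreover have "a * k + b * l \<le> sqrt (89 / 50 * k * l)"
  proof -
    have "a \<le> real l / k" unfolding a_def using kl by (intro ln_add_one_self_le_self) auto
    then have "a * k \<le> l" using kl by (simp add: pos_le_divide_eq)
    then have "a * k + b * l \<le> l * (1 + b)" by (simp add: algebra_simps)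
    also have "\<dots> \<le> l * sqrt (89 / 50 * (real k / l))"
      unfolding b_def using kl by (intro mult_left_mono ln_le_sqrt) auto
    also have "\<dots> = sqrt (real l^2 * (89 / 50 * (real k / l)))"
      by (simp only: real_sqrt_mult real_sqrt_abs abs_of_nat)
    also have "real l^2 * (89 / 50 * (real k / l)) = 89 / 50 * k * l"
      using kl by (simp add: power2_eq_square)
    finally show ?thesis .
  qed
  ultimately show ?thesis by (elim ramsey_bound_mono) simp
qed

text \<open>The linear error of the table is harmless where the ratio is at most 10: there
  \<open>k + l \<le> 11 * l\<close>, and \<open>l\<close> is at most the square root, hence
  \<open>\<delta> / 11\<close>. For larger ratios there is no such error.\<close>

lemma ramsey_bound_sqrt:
  fixes \<delta> :: real
  assumes "\<delta> > 0"
  shows "\<exists>C\<ge>1. \<forall>k l. 1 \<le> k \<longrightarrow> 1 \<le> l \<longrightarrow> ramsey_bound k l (C * exp ((1 + \<delta>) * sqrt (89 / 50 * k * l)))"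
proof -
  obtain C where C: "C \<ge> 1" "\<And>k l a b. (a, b) \<in> set lower_lines \<Longrightarrow>
      ramsey_bound k l (C * exp (\<delta> / 11 * (real k + real l) + a / 10 ^ 5 * k + b / 10 ^ 5 * l))"
    using ramsey_bound_table[of "\<delta> / 11"] assms by auto
  have main: "ramsey_bound k l (C * exp ((1 + \<delta>) * sqrt (89 / 50 * k * l)))" if kl: "1 \<le> l" "l \<le> k" for k l
  proof -
    define Q where "Q = sqrt (89 / 50 * k * l)"
    have Q: "Q \<ge> 0" by (simp add: Q_def)
    show ?thesis
    proof (cases "k \<le> 10 * l")
      case True
      then obtain a b where ab: "(a, b) \<in> set lower_lines" "a / 10 ^ 5 * k + b / 10 ^ 5 * l \<le> Q"
        using lower_line_sqrt[OF kl] unfolding Q_def by blast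
      have "real l \<le> Q" unfolding Q_def
      proof (rule real_le_rsqrt)
        have "real l * real l \<le> real k * real l" using kl by (intro mult_right_mono) auto
        also have "\<dots> \<le> 89 / 50 * (real k * real l)" by simp
        finally show "(real l)^2 \<le> 89 / 50 * k * l" by (simp add: power2_eq_square)
      qed
      moreover have "real k + real l \<le> 11 * real l" using True by simp
      ultimately have "\<delta> / 11 * (real k + real l) \<le> \<delta> / 11 * (11 * Q)"
        using assms by (intro mult_left_mono) auto
      then have "\<delta> / 11 * (real k + real l) + a / 10 ^ 5 * k + b / 10 ^ 5 * l \<le> (1 + \<delta>) * Q"
      proof -
        have "(1 + \<delta>) * Q = \<delta> / 11 * (11 * Q) + Q" by (simp add: algebra_simps)
        then show ?thesis using ab(2) \<open>\<delta> / 11 * (real k + real l) \<le> \<delta> / 11 * (11 * Q)\<close> by linarith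
      qed
      then have "C * exp (\<delta> / 11 * (real k + real l) + a / 10 ^ 5 * k + b / 10 ^ 5 * l) \<le> C * exp ((1 + \<delta>) * Q)"
        using C(1) by (intro mult_left_mono) auto
      then show ?thesis unfolding Q_def[symmetric] using C(2)[OF ab(1)] ramsey_bound_mono by blast
    next
      case False
      then have "ramsey_bound k l (exp Q)" unfolding Q_def using kl by (intro ramsey_bound_unbalanced) auto
      moreover have "1 * exp Q \<le> C * exp ((1 + \<delta>) * Q)"
        using C(1) Q assms by (intro mult_mono) (auto simp: algebra_simps)
      ultimately show ?thesis unfolding Q_def[symmetric] using ramsey_bound_mono by simp
    qed
  qed
  have "ramsey_bound k l (C * exp ((1 + \<delta>) * sqrt (89 / 50 * k * l)))" if kl: "1 \<le> k" "1 \<le> l" for k l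
  proof (cases "l \<le> k")
    case True
    then show ?thesis using main kl by blast
  next
    case False
    then have "ramsey_bound l k (C * exp ((1 + \<delta>) * sqrt (89 / 50 * l * k)))" using kl by (intro main) auto
    then have "ramsey_bound k l (C * exp ((1 + \<delta>) * sqrt (89 / 50 * l * k)))" by (rule ramsey_bound_swap)
    then show ?thesis by (simp add: mult.commute mult.left_commute)
  qed
  then show ?thesis using C(1) by blast
qed

section \<open>Colouring with large independent sets\<close>

lemma greedy_colouring:
  fixes m :: real
  assumes "finite S" "0 \<le> m" "1 \<le> t"
    and indep: "\<And>S'. S' \<subseteq> S \<Longrightarrow> m \<le> card S' \<Longrightarrow> has_clique (\<lambda>u v. u \<noteq> v \<and> {u, v} \<notin> E) S' t"
    and loop: "\<And>v. {v, v} \<notin> E"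
  shows "\<exists>q c. (\<forall>v\<in>S. c v < q) \<and> (\<forall>u\<in>S. \<forall>v\<in>S. {u, v} \<in> E \<longrightarrow> c u \<noteq> c v) \<and> real q \<le> card S / t + m"
  using assms(1) indep
proof (induction "card S" arbitrary: S rule: less_induct)
  case less
  show ?case
  proof (cases "m \<le> card S")
    case False
    \<comment> \<open>The remainder, with fewer than \<open>m\<close> vertices, gets one colour per
      vertex; this is the summand \<open>m\<close>.\<close>
    obtain c where c: "bij_betw c S {0..<card S}" using less.prems(1) ex_bij_betw_finite_nat by blast
    have "c v < card S" if "v \<in> S" for v using c that bij_betwE by fastforce
    moreover have "c u \<noteq> c v" if "u \<in> S" "v \<in> S" "{u, v} \<in> E" for u v
      using c that loop unfolding bij_betw_def inj_on_def by metis
    moreover have "0 \<le> card S / t" by simp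
    then have "real (card S) \<le> card S / t + m" using False by linarith
    ultimately show ?thesis by blast
  next
    case True
    then obtain I where I: "I \<subseteq> S" "finite I" "card I = t" "\<forall>u\<in>I. \<forall>v\<in>I. u \<noteq> v \<longrightarrow> u \<noteq> v \<and> {u, v} \<notin> E"
      using less.prems(2)[of S] unfolding has_clique_def by blast
    have cI: "card (S - I) = card S - t" "t \<le> card S"
      using I less.prems(1) by (auto simp: card_Diff_subset card_mono)
    then have "card (S - I) < card S" using assms(3) by simp
    moreover have "has_clique (\<lambda>u v. u \<noteq> v \<and> {u, v} \<notin> E) S' t" if "S' \<subseteq> S - I" "m \<le> card S'" for S'
      using that by (intro less.prems(2)) auto
    ultimately obtain q c where qc: "\<forall>v\<in>S - I. c v < q"
        "\<forall>u\<in>S - I. \<forall>v\<in>S - I. {u, v} \<in> E \<longrightarrow> c u \<noteq> c v" "real q \<le> card (S - I) / t + m"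
      using less.hyps[of "S - I"] less.prems(1) by blast
    define c' where "c' = (\<lambda>v. if v \<in> I then q else c v)"
    have "\<forall>v\<in>S. c' v < Suc q" using qc(1) by (auto simp: c'_def less_SucI)
    moreover have "c' u \<noteq> c' v" if "u \<in> S" "v \<in> S" "{u, v} \<in> E" for u v
    proof -
      have "u \<noteq> v" using that loop by auto
      then have "\<not> (u \<in> I \<and> v \<in> I)" using I(4) that(3) by blast
      then show ?thesis using qc(1,2) that by (auto simp: c'_def dest: less_imp_neq)
    qed
    moreover have "real (Suc q) \<le> card S / t + m"
    proof -
      have "real (card (S - I)) / t = card S / t - 1"
        using cI assms(3) by (simp add: of_nat_diff diff_divide_distrib)
      then show ?thesis using qc(3) by simp
    qed
    ultimately show ?thesis by blast
  qed
qed

lemma chromatic_number_le: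
  assumes "\<forall>v\<in>{0..<n}. c v < q" "\<forall>u\<in>{0..<n}. \<forall>v\<in>{0..<n}. {u, v} \<in> E \<longrightarrow> c u \<noteq> c v"
  shows "chromatic_number n E \<le> q"
  unfolding chromatic_number_def by (rule Least_le) (use assms in \<open>auto intro!: exI[of _ c]\<close>)

lemma finite_cliques: "finite {K. is_clique n E K}"
  by (rule finite_subset[of _ "Pow {0..<n}"]) (auto simp: is_clique_def)

lemma clique_number_ge: "is_clique n E K \<Longrightarrow> card K \<le> clique_number n E"
  unfolding clique_number_def using finite_cliques by (intro Max_ge) auto

text \<open>Edges are red and non-edges blue. Red cliques larger than the clique number do not
  occur, so every set of \<open>m\<close> vertices contains an independent set of size
  \<open>t\<close>.\<close>

lemma graph_ratio_le:
  fixes n :: nat and m :: real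
  assumes E: "is_graph n E" and n: "1 \<le> n"
    and t: "1 \<le> t" and m: "0 \<le> m" and rb: "ramsey_bound (Suc (clique_number n E)) t m"
  shows "real (chromatic_number n E) \<le> real n / t + m"
proof -
  define R where "R = (\<lambda>u v :: nat. u \<noteq> v \<and> {u, v} \<in> E)"
  define B where "B = (\<lambda>u v :: nat. u \<noteq> v \<and> {u, v} \<notin> E)"
  have RB: "two_colouring R B"
    by unfold_locales (auto simp: R_def B_def insert_commute)
  have loop: "{v, v} \<notin> E" for v using E unfolding is_graph_def by fastforce
  have "has_clique B S t" if S: "S \<subseteq> {0..<n}" "m \<le> card S" for S
  proof -
    have "finite S" using S finite_subset by blast
    moreover have "\<not> has_clique R S (Suc (clique_number n E))"
    proof
      assume "has_clique R S (Suc (clique_number n E))"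
      then obtain K where K: "K \<subseteq> S" "card K = Suc (clique_number n E)" "\<forall>u\<in>K. \<forall>v\<in>K. u \<noteq> v \<longrightarrow> R u v"
        unfolding has_clique_def by blast
      then have "is_clique n E K" using S unfolding is_clique_def R_def by auto
      then show False using clique_number_ge K(2) by fastforce
    qed
    ultimately show ?thesis using rb RB S(2) unfolding ramsey_bound_def by blast
  qed
  then obtain q c where "\<forall>v\<in>{0..<n}. c v < q" "\<forall>u\<in>{0..<n}. \<forall>v\<in>{0..<n}. {u, v} \<in> E \<longrightarrow> c u \<noteq> c v"
      "real q \<le> card {0..<n} / t + m"
    using greedy_colouring[of "{0..<n}" m t E] m t loop unfolding B_def by auto
  then show ?thesis using chromatic_number_le[of n c q E] by simp
qed

lemma chromatic_number_trivial: "is_graph n E \<Longrightarrow> chromatic_number n E \<le> n"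
proof (rule chromatic_number_le[where c = id])
  assume "is_graph n E"
  then have "{v, v} \<notin> E" for v unfolding is_graph_def by fastforce
  then show "\<forall>u\<in>{0..<n}. \<forall>v\<in>{0..<n}. {u, v} \<in> E \<longrightarrow> id u \<noteq> id v" by auto
qed auto

lemma clique_number_pos: "1 \<le> n \<Longrightarrow> 1 \<le> clique_number n E"
  using clique_number_ge[of n E "{0}"] by (simp add: is_clique_def)

lemma f_ratio_le:
  assumes "\<And>E. is_graph n E \<Longrightarrow> real (chromatic_number n E) / real (clique_number n E) \<le> x"
  shows "f_ratio n \<le> x"
proof -
  have fin: "finite {E. is_graph n E}"
    by (rule finite_subset[of _ "Pow (Pow {0..<n})"]) (auto simp: is_graph_def)
  have eq: "{real (chromatic_number n E) / real (clique_number n E) | E. is_graph n E}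
      = (\<lambda>E. real (chromatic_number n E) / real (clique_number n E)) ` {E. is_graph n E}" by auto
  have "is_graph n {}" by (simp add: is_graph_def)
  then show ?thesis unfolding f_ratio_def eq using fin assms by (subst Max_le_iff) auto
qed

section \<open>Rounding and asymptotics\<close>

lemma ln2_ge_693: "693 / 1000 \<le> ln (2 :: real)"
  using ln_approx_bounds[of 2 4] by (simp add: eval_nat_numeral)

text \<open>Passing from \<open>w\<close> to \<open>Suc w\<close> and from \<open>x\<close> to its
  ceiling costs relative errors of order \<open>1 / T\<close>, absorbed by \<open>\<delta>\<close>
  when both parameters are at least \<open>T\<close>. If one of them is below \<open>T\<close>, the
  binomial bound is polynomial in \<open>L\<close>.\<close>

lemma ramsey_bound_rounded:
  fixes \<delta> L C x N :: real and w T t :: nat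
  assumes \<delta>: "0 < \<delta>" "\<delta> \<le> 1 / 2" and T: "4 / \<delta> \<le> T" and w: "1 \<le> w" "w \<le> L^2" and L: "1 \<le> L"
    and C: "\<And>k l. 1 \<le> k \<Longrightarrow> 1 \<le> l \<Longrightarrow> ramsey_bound k l (C * exp ((1 + \<delta> / 8) * sqrt (89 / 50 * k * l)))" "1 \<le> C"
    and x: "x = (1 - \<delta>) * L^2 / (89 / 50 * w)" and t: "x \<le> t" "t < x + 1" "1 \<le> t"
    and N: "C * exp ((1 - \<delta> / 8) * L) \<le> N" "(2 * L^2 + 2) ^ T \<le> N"
  shows "ramsey_bound (Suc w) t N"
proof (cases "Suc w < T \<or> t < T")
  case True
  have "x \<le> L^2"
  proof -
    have "(1 - \<delta>) * L^2 \<le> 1 * L^2" using \<delta> by (intro mult_right_mono) auto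
    also have "\<dots> = L^2 * 1" by simp
    also have "\<dots> \<le> L^2 * (89 / 50 * w)" using w(1) by (intro mult_left_mono) auto
    finally show ?thesis unfolding x using w by (simp add: pos_divide_le_eq)
  qed
  then have sum: "real (Suc w + t) \<le> 2 * L^2 + 2" using w t by simp
  have pow: "real (Suc w + t) ^ i \<le> (2 * L^2 + 2) ^ T" if "i < T" for i
  proof -
    have "real (Suc w + t) ^ i \<le> (2 * L^2 + 2) ^ i" using sum by (intro power_mono) auto
    also have "\<dots> \<le> (2 * L^2 + 2) ^ T" using that by (intro power_increasing) auto
    finally show ?thesis .
  qed
  have "real ((Suc w + t) choose Suc w) \<le> (2 * L^2 + 2) ^ T"
    using True
  proof
    assume "Suc w < T"
    have "(Suc w + t) choose Suc w \<le> (Suc w + t) ^ Suc w" by (rule binomial_le_pow) simp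
    then have "real ((Suc w + t) choose Suc w) \<le> real (Suc w + t) ^ Suc w"
      unfolding of_nat_power[symmetric] of_nat_le_iff .
    then show ?thesis using pow[OF \<open>Suc w < T\<close>] by linarith
  next
    assume "t < T"
    have "(Suc w + t) choose Suc w = (Suc w + t) choose t"
      using binomial_symmetric[of "Suc w" "Suc w + t"] by simp
    also have "\<dots> \<le> (Suc w + t) ^ t" by (rule binomial_le_pow) simp
    finally have "real ((Suc w + t) choose Suc w) \<le> real (Suc w + t) ^ t"
      unfolding of_nat_power[symmetric] of_nat_le_iff .
    then show ?thesis using pow[OF \<open>t < T\<close>] by linarith
  qed
  then show ?thesis using N(2) by (intro ramsey_bound_mono[OF ramsey_bound_binomial]) linarith
next
  case False
  \<comment> \<open>One factor \<open>y\<close> undoes each of the two roundings, as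
    \<open>\<delta> / 4\<close> of a number that is at least \<open>T\<close> is at least 1. The
    margin suffices because \<open>1 - \<delta> \<le> y ^ 4\<close>.\<close>
  define y where "y = 1 - \<delta> / 4"
  have T0: "real T > 0" using T \<delta> by (intro less_le_trans[OF _ T]) simp
  have "4 \<le> T * \<delta>" using T \<delta> by (simp add: pos_divide_le_eq)
  then have T1: "1 \<le> \<delta> / 4 * T" by (simp add: mult.commute)
  have y: "y > 0" using \<delta> by (simp add: y_def)
  have "\<delta> / 4 * T \<le> \<delta> / 4 * Suc w" "\<delta> / 4 * T \<le> \<delta> / 4 * t"
    using False \<delta> by (intro mult_left_mono; simp)+
  then have wy: "Suc w * y \<le> w" and ty: "t * y \<le> x"
    using T1 t by (simp_all add: y_def algebra_simps)
  have "(Suc w * y) * (t * y) \<le> w * x" using wy ty y by (intro mult_mono) auto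
  also have "\<dots> = (1 - \<delta>) * L^2 / (89 / 50)" using w by (simp add: x)
  finally have "(Suc w * y) * (t * y) * (89 / 50) \<le> (1 - \<delta>) * L^2"
    by (subst (asm) pos_le_divide_eq) simp_all
  moreover have "(89 / 50 * Suc w * t) * y^2 = (Suc w * y) * (t * y) * (89 / 50)"
    by (simp add: power2_eq_square algebra_simps)
  ultimately have "(89 / 50 * Suc w * t) * y^2 \<le> (1 - \<delta>) * L^2" by (simp only:)
  also have "\<dots> \<le> (y^2 * L)^2"
  proof -
    have "1 - \<delta> \<le> (1 - \<delta> / 2)^2" by (simp add: power2_eq_square algebra_simps)
    also have "\<dots> \<le> (y^2)^2"
      using \<delta> by (intro power_mono) (auto simp: y_def power2_eq_square algebra_simps)
    finally have "(1 - \<delta>) * L^2 \<le> (y^2)^2 * L^2" by (intro mult_right_mono) auto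
    then show ?thesis by (simp add: power_mult_distrib)
  qed
  also have "\<dots> = (y * L)^2 * y^2" by (simp add: power2_eq_square algebra_simps)
  finally have "89 / 50 * Suc w * t \<le> (y * L)^2" using y by (simp add: mult_le_cancel_right)
  then have "sqrt (89 / 50 * Suc w * t) \<le> y * L" using y L by (intro real_le_lsqrt) auto
  then have "(1 + \<delta> / 8) * sqrt (89 / 50 * Suc w * t) \<le> (1 + \<delta> / 8) * (y * L)"
    using \<delta> by (intro mult_left_mono) auto
  also have "\<dots> \<le> (1 - \<delta> / 8) * L"
  proof -
    have "(1 + \<delta> / 8) * y \<le> 1 - \<delta> / 8" using \<delta> by (simp add: y_def algebra_simps)
    then have "((1 + \<delta> / 8) * y) * L \<le> (1 - \<delta> / 8) * L" using L by (intro mult_right_mono) auto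
    then show ?thesis by (simp add: mult.assoc)
  qed
  finally have "C * exp ((1 + \<delta> / 8) * sqrt (89 / 50 * Suc w * t)) \<le> C * exp ((1 - \<delta> / 8) * L)"
    using C(2) by (intro mult_left_mono) auto
  then have "C * exp ((1 + \<delta> / 8) * sqrt (89 / 50 * Suc w * t)) \<le> N" using N(1) by (rule order_trans)
  then show ?thesis using t(3) by (intro ramsey_bound_mono[OF C(1)]) auto
qed

lemma f_ratio_asymptotic:
  fixes \<epsilon> :: real
  assumes \<epsilon>: "\<epsilon> > 0"
  shows "\<forall>\<^sub>F n in sequentially. f_ratio n \<le> (3.70831 + \<epsilon>) * real n / (log 2 (real n))^2"
proof -
  \<comment> \<open>Natural logarithms scale \<open>\<epsilon>\<close> by the square of
    \<open>ln 2\<close>, slightly above 12/25. One half, 6/25, pays for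
    \<open>1 / (1 - \<delta>)\<close>, the other for the uncoloured remainder.\<close>
  define \<delta> where "\<delta> = min (1 / 2) (\<epsilon> / 20)"
  have \<delta>: "0 < \<delta>" "\<delta> \<le> 1 / 2" "\<delta> \<le> \<epsilon> / 20" using \<epsilon> by (auto simp: \<delta>_def)
  obtain T :: nat where T: "4 / \<delta> \<le> T" using real_arch_simple by blast
  obtain C where C: "C \<ge> 1" "\<And>k l. 1 \<le> k \<Longrightarrow> 1 \<le> l \<Longrightarrow>
      ramsey_bound k l (C * exp ((1 + \<delta> / 8) * sqrt (89 / 50 * k * l)))"
    using ramsey_bound_sqrt[of "\<delta> / 8"] \<delta> by auto
  have "\<forall>\<^sub>F n in sequentially. C * exp ((1 - \<delta> / 8) * ln (real n)) \<le> real n / ln (real n) ^ 3"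
    using \<delta> by real_asymp
  moreover have "\<forall>\<^sub>F n in sequentially. (2 * ln (real n) ^ 2 + 2) ^ T \<le> real n / ln (real n) ^ 3"
    by real_asymp
  moreover have "\<forall>\<^sub>F n in sequentially. real n / ln (real n) ^ 3 \<le> 6 / 25 * \<epsilon> * (real n / ln (real n) ^ 2)"
    using \<epsilon> by real_asymp
  moreover have "\<forall>\<^sub>F n in sequentially. 1 \<le> ln (real n)" by real_asymp
  moreover have "\<forall>\<^sub>F n :: nat in sequentially. 1 \<le> n" by (rule eventually_ge_at_top)
  ultimately show ?thesis
  proof eventually_elim
    case (elim n)
    define L where "L = ln (real n)"
    define Q where "Q = real n / L^2"
    note E = elim[folded L_def]
    have n: "1 \<le> n" and L: "1 \<le> L" using E by auto
    have Q: "Q > 0" using n L by (simp add: Q_def)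
    have "f_ratio n \<le> (89 / 50 + 12 / 25 * \<epsilon>) * Q"
    proof (rule f_ratio_le)
      fix E' assume G: "is_graph n E'"
      define w where "w = clique_number n E'"
      have w: "1 \<le> w" unfolding w_def by (rule clique_number_pos[OF n])
      show "real (chromatic_number n E') / real (clique_number n E') \<le> (89 / 50 + 12 / 25 * \<epsilon>) * Q"
      proof (cases "real w \<le> L^2")
        \<comment> \<open>For a clique number above \<open>L^2\<close>, even \<open>n\<close>
          colours are few enough.\<close>
        case False
        have "real (chromatic_number n E') / w \<le> real n / w"
          using chromatic_number_trivial[OF G] by (intro divide_right_mono) auto
        also have "\<dots> \<le> 1 * Q" unfolding Q_def using False L w by (auto intro!: divide_left_mono)
        also have "\<dots> \<le> (89 / 50 + 12 / 25 * \<epsilon>) * Q" using Q \<epsilon> by (intro mult_right_mono) auto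
        finally show ?thesis unfolding w_def .
      next
        case True
        \<comment> \<open>Chosen so that \<open>89 / 50 * w * x = (1 - \<delta>) * L^2\<close>: the
          Ramsey exponent for \<open>w\<close> and \<open>x\<close> stays below \<open>ln n\<close>
          by a constant factor.\<close>
        define x where "x = (1 - \<delta>) * L^2 / (89 / 50 * w)"
        define t where "t = nat \<lceil>x\<rceil>"
        have x: "x > 0" using \<delta> L w by (simp add: x_def)
        then have t: "x \<le> t" "t < x + 1" "1 \<le> t" unfolding t_def by (auto, linarith+)
        have "ramsey_bound (Suc w) t (real n / L ^ 3)"
          by (rule ramsey_bound_rounded[OF \<delta>(1,2) T w True L C(2) C(1) x_def t]) (use E in auto)
        then have "real (chromatic_number n E') \<le> real n / t + real n / L ^ 3"
          using G n t(3) L unfolding w_def by (intro graph_ratio_le) auto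
        also have "\<dots> \<le> real n / x + w * (real n / L ^ 3)"
        proof (rule add_mono)
          show "real n / t \<le> real n / x" using x t by (intro divide_left_mono) auto
          have "1 * (real n / L ^ 3) \<le> w * (real n / L ^ 3)" using w L by (intro mult_right_mono) auto
          then show "real n / L ^ 3 \<le> w * (real n / L ^ 3)" by simp
        qed
        also have "\<dots> \<le> real n / x + w * (6 / 25 * \<epsilon> * Q)"
          using E(3) by (intro add_left_mono mult_left_mono) (auto simp: Q_def)
        also have "real n / x = w * (89 / 50 / (1 - \<delta>) * Q)"
        proof -
          have "real n / (d * L^2 / (89 / 50 * w)) = w * (89 / 50 / d * (real n / L^2))" if "d \<noteq> 0" for d :: real
            using that L w by (simp add: mult_ac)
          then show ?thesis unfolding x_def Q_def using \<delta> by simp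
        qed
        also have "\<dots> \<le> w * ((89 / 50 + 6 / 25 * \<epsilon>) * Q)"
        proof (intro mult_left_mono mult_right_mono)
          have "89 / 50 \<le> (89 / 50 + 356 / 100 * \<delta>) * (1 - \<delta>)"
          proof -
            have "0 \<le> \<delta> * (1 / 2 - \<delta>)" using \<delta> by simp
            moreover have "(89 / 50 + 356 / 100 * \<delta>) * (1 - \<delta>) = 89 / 50 + 356 / 100 * (\<delta> * (1 / 2 - \<delta>))"
              by (simp add: field_simps)
            ultimately show ?thesis by linarith
          qed
          then have "89 / 50 / (1 - \<delta>) \<le> 89 / 50 + 356 / 100 * \<delta>"
            using \<delta>(2) by (subst pos_divide_le_eq) simp_all
          then show "89 / 50 / (1 - \<delta>) \<le> 89 / 50 + 6 / 25 * \<epsilon>" using \<delta>(3) \<delta>(1) by simp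
        qed (use Q in auto)
        finally have "real (chromatic_number n E') \<le> ((89 / 50 + 12 / 25 * \<epsilon>) * Q) * w"
          by (simp add: algebra_simps)
        then show ?thesis unfolding w_def[symmetric] using w by (simp add: pos_divide_le_eq)
      qed
    qed
    also have "\<dots> \<le> ((3.70831 + \<epsilon>) * ln 2 ^ 2) * Q"
    proof (rule mult_right_mono)
      have "(693 / 1000)^2 \<le> ln (2 :: real) ^ 2" using ln2_ge_693 by (intro power_mono) auto
      then have "(3.70831 + \<epsilon>) * (693 / 1000)^2 \<le> (3.70831 + \<epsilon>) * ln 2 ^ 2"
        using \<epsilon> by (intro mult_left_mono) auto
      moreover have "89 / 50 + 12 / 25 * \<epsilon> \<le> (3.70831 + \<epsilon>) * (693 / 1000)^2"
        using \<epsilon> by (simp add: power2_eq_square algebra_simps)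
      ultimately show "89 / 50 + 12 / 25 * \<epsilon> \<le> (3.70831 + \<epsilon>) * ln 2 ^ 2" by linarith
    qed (use Q in simp)
    also have "\<dots> = (3.70831 + \<epsilon>) * real n / (log 2 (real n))^2"
      by (simp add: Q_def L_def log_def power_divide)
    finally show ?case .
  qed
qed

theorem theorem1p3:
  shows "(\<forall>\<epsilon>>0. \<forall>\<^sub>F n in sequentially.
            f_ratio n \<le> (3.71943 + \<epsilon>) * real n / (log 2 (real n))^2)
       \<and> ((\<forall>s t k. 0 < s \<and> 0 < t \<and> 0 < k \<and> s * t \<le> k^2 \<longrightarrow> ramsey s t \<le> ramsey k k)
          \<longrightarrow> (\<forall>\<epsilon>>0. \<forall>\<^sub>F n in sequentially.
                f_ratio n \<le> (3.70831 + \<epsilon>) * real n / (log 2 (real n))^2))"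
proof (intro conjI impI allI)
  fix \<epsilon> :: real
  assume \<epsilon>: "\<epsilon> > 0"
  then show "\<forall>\<^sub>F n in sequentially. f_ratio n \<le> (3.70831 + \<epsilon>) * real n / (log 2 (real n))^2"
    by (rule f_ratio_asymptotic)
  then show "\<forall>\<^sub>F n in sequentially. f_ratio n \<le> (3.71943 + \<epsilon>) * real n / (log 2 (real n))^2"
  proof eventually_elim
    case (elim n)
    also have "(3.70831 + \<epsilon>) * real n / (log 2 (real n))^2 \<le> (3.71943 + \<epsilon>) * real n / (log 2 (real n))^2"
      by (intro divide_right_mono mult_right_mono) auto
    finally show ?case .
  qed
qed

end
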